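(* Let $d=2$ and fix an integer $\kappa\ge 2$. Let $J_2=J_2(\kappa)=\left(2\cos(\pi/\kappa),\,1+\cos(\pi/\kappa)\right)$. There is a strictly decreasing sequence of energies $\{\mathcal{E}_n\}_{n=1}^\infty=\{\mathcal{E}_n(\kappa)\}_{n=1}^\infty$, depending on $\kappa$, such that $\{\mathcal{E}_n\}\subset J_2\cap\boldsymbol{\Theta}_\kappa(\Delta)$ and $\mathcal{E}_n\searrow \inf J_2=2\cos(\pi/\kappa)$ as $n\to\infty$. Also, $\mathcal{E}_{2n-1}\in\boldsymbol{\Theta}_{n,\kappa}(\Delta)$ and $\mathcal{E}_{2n}\in\boldsymbol{\Theta}_{n,\kappa}(\Delta)$ for all $n\ge1$.
   Context: $\mathbb{N}^*=\{1,2,\dots\}$. Here $d=2$. On $\mathscr{H}=\ell^2(\mathbb{Z}^d)$ let $(S_i^{\pm1}u)(n)=u(n_1,\dots,n_i\mp1,\dots,n_d)$, $\Delta=\sum_{i=1}^d\frac12(S_i+S_i^{*})$ (so $\sigma(\Delta)=[-d,d]$), and $(N_iu)(n)=n_iu(n)$. For $j,\kappa\in\mathbb{N}^*$ let $A_i(j,\kappa)$ be the closure of the operator $\frac{1}{4\mathrm{i}}\left[(S_i^{j\kappa}-S_i^{-j\kappa})N_i+N_i(S_i^{j\kappa}-S_i^{-j\kappa})\right]$ defined on compactly supported sequences, and $A_{j\kappa}=\sum_{i=1}^dA_i(j,\kappa)$ (self-adjoint). The conjugate operators considered are the self-adjoint linear combinations (finite or infinite) $\mathbb{A}=\sum_{j\ge1}\rho_{j\kappa}A_{j\kappa}$,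 $\rho_{j\kappa}\in\mathbb{R}$; $[\Delta,\mathrm{i}\mathbb{A}]_\circ$ is the bounded extension to $\mathscr{H}$ of the commutator initially defined on compactly supported sequences. $\boldsymbol{\mu}_\kappa(\Delta)$ is the set of $E\in\sigma(\Delta)$ for which there exist such an $\mathbb{A}$, an open interval $I\ni E$ and $\gamma>0$ with $1_I(\Delta)[\Delta,\mathrm{i}\mathbb{A}]_\circ1_I(\Delta)\ge\gamma1_I(\Delta)$ ($1_I(\Delta)$ is the spectral projection). $\boldsymbol{\Theta}_\kappa(\Delta)=\sigma(\Delta)\setminus\boldsymbol{\mu}_\kappa(\Delta)$. Let $U_n$ be the Chebyshev polynomial of the second kind of degree $n$. For $\vec{x}=(x_1,\dots,x_d)\in[-1,1]^d$ let $g_{j\kappa}(\vec{x})=\sum_{i=1}^d(1-x_i^2)U_{j\kappa-1}(x_i)$, and for $E\in\sigma(\Delta)$ let $S_E=\{\vec{x}\in[-1,1]^d: x_1+\dots+x_d=E\}$. For $m\in\mathbb{N}^*$, $E\in\boldsymbol{\Theta}_{m,\kappa}(\Delta)$ iff there exist $\vec{x}_0,\dots,\vec{x}_m\in S_E$ and real numbers $\omega_0,\dots,\omega_{m-1}\le0$ such that $g_{j\kappa}(\vec{x}_m)=\sum_{q=0}^{m-1}\omega_q\,g_{j\kappa}(\vec{x}_q)$ for all $j\in\mathbb{N}^*$. *)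

theory Defs
  imports "HOL-Analysis.Analysis"
begin

section \<open>The Hilbert space of square-summable families\<close>

typedef 'a ell2 = "{f :: 'a \<Rightarrow> complex. (\<lambda>n. (cmod (f n))\<^sup>2) summable_on UNIV}"
  morphisms seq Abs_ell2
  by (intro exI[of _ "\<lambda>_. 0"]) simp

setup_lifting type_definition_ell2

lemma ell2_mult_summable:
  fixes f g :: "'a \<Rightarrow> complex"
  assumes "(\<lambda>n. (cmod (f n))\<^sup>2) summable_on UNIV" and "(\<lambda>n. (cmod (g n))\<^sup>2) summable_on UNIV"
  shows "(\<lambda>n. cmod (f n) * cmod (g n)) summable_on UNIV"
proof (rule summable_on_comparison_test)
  show "(\<lambda>n. (cmod (f n))\<^sup>2 + (cmod (g n))\<^sup>2) summable_on UNIV"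
    using assms by (rule summable_on_add)
  show "cmod (f n) * cmod (g n) \<le> (cmod (f n))\<^sup>2 + (cmod (g n))\<^sup>2" for n
    using sum_squares_bound[of "cmod (f n)" "cmod (g n)"]
      mult_nonneg_nonneg[OF norm_ge_zero[of "f n"] norm_ge_zero[of "g n"]] by linarith
qed auto

lemma ell2_add_summable:
  fixes f g :: "'a \<Rightarrow> complex"
  assumes "(\<lambda>n. (cmod (f n))\<^sup>2) summable_on UNIV" and "(\<lambda>n. (cmod (g n))\<^sup>2) summable_on UNIV"
  shows "(\<lambda>n. (cmod (f n + g n))\<^sup>2) summable_on UNIV"
proof (rule summable_on_comparison_test)
  show "(\<lambda>n. 2 * ((cmod (f n))\<^sup>2 + (cmod (g n))\<^sup>2)) summable_on UNIV"
    using assms by (intro summable_on_cmult_right summable_on_add)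
  fix n
  have "(cmod (f n + g n))\<^sup>2 \<le> (cmod (f n) + cmod (g n))\<^sup>2"
    by (intro power_mono norm_triangle_ineq norm_ge_zero)
  also have "\<dots> \<le> 2 * ((cmod (f n))\<^sup>2 + (cmod (g n))\<^sup>2)"
    using sum_squares_bound[of "cmod (f n)" "cmod (g n)"] by (simp add: power2_sum)
  finally show "(cmod (f n + g n))\<^sup>2 \<le> 2 * ((cmod (f n))\<^sup>2 + (cmod (g n))\<^sup>2)" .
qed auto

lemma ell2_scale_summable:
  fixes f :: "'a \<Rightarrow> complex" and c :: complex
  assumes "(\<lambda>n. (cmod (f n))\<^sup>2) summable_on UNIV"
  shows "(\<lambda>n. (cmod (c * f n))\<^sup>2) summable_on UNIV"
  using summable_on_cmult_right[OF assms, of "(cmod c)\<^sup>2"]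
  by (simp add: norm_mult power_mult_distrib)

lemma ell2_inner_summable:
  fixes f g :: "'a \<Rightarrow> complex"
  assumes "(\<lambda>n. (cmod (f n))\<^sup>2) summable_on UNIV" and "(\<lambda>n. (cmod (g n))\<^sup>2) summable_on UNIV"
  shows "(\<lambda>n. f n \<bullet> g n) summable_on UNIV"
proof (rule abs_summable_summable, rule summable_on_comparison_test)
  show "(\<lambda>n. cmod (f n) * cmod (g n)) summable_on UNIV"
    using assms by (rule ell2_mult_summable)
  show "norm (f n \<bullet> g n) \<le> cmod (f n) * cmod (g n)" for n
    using Cauchy_Schwarz_ineq2 by simp
qed auto

lemma ell2_cinner_summable:
  fixes f g :: "'a \<Rightarrow> complex"
  assumes "(\<lambda>n. (cmod (f n))\<^sup>2) summable_on UNIV" and "(\<lambda>n. (cmod (g n))\<^sup>2) summable_on UNIV"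
  shows "(\<lambda>n. cnj (f n) * g n) summable_on UNIV"
  by (rule abs_summable_summable) (use ell2_mult_summable[OF assms] in \<open>simp add: norm_mult\<close>)

lift_definition cscale :: "complex \<Rightarrow> 'a ell2 \<Rightarrow> 'a ell2" is "\<lambda>c f n. c * f n"
  by (rule ell2_scale_summable)

lift_definition cinner :: "'a ell2 \<Rightarrow> 'a ell2 \<Rightarrow> complex"
  is "\<lambda>f g. \<Sum>\<^sub>\<infinity>n. cnj (f n) * g n" .

text \<open>The library has no class of complex inner product spaces. The topology comes from the
  underlying real inner product, which is the real part of \<^const>\<open>cinner\<close>.\<close>

instantiation ell2 :: (type) real_vector
begin

lift_definition zero_ell2 :: "'a ell2" is "\<lambda>_. 0" by simp

lift_definition plus_ell2 :: "'a ell2 \<Rightarrow> 'a ell2 \<Rightarrow> 'a ell2" is "\<lambda>f g n. f n + g n"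
  by (rule ell2_add_summable)

lift_definition uminus_ell2 :: "'a ell2 \<Rightarrow> 'a ell2" is "\<lambda>f n. - f n" by simp

lift_definition minus_ell2 :: "'a ell2 \<Rightarrow> 'a ell2 \<Rightarrow> 'a ell2" is "\<lambda>f g n. f n - g n"
  subgoal for f g using ell2_add_summable[of f "\<lambda>n. - g n"] by simp
  done

lift_definition scaleR_ell2 :: "real \<Rightarrow> 'a ell2 \<Rightarrow> 'a ell2" is "\<lambda>r f n. r *\<^sub>R f n"
  subgoal for r f using ell2_scale_summable[of f "of_real r"] by (simp add: scaleR_conv_of_real)
  done

instance
proof
  fix u v w :: "'a ell2" and a b :: real
  show "u + v + w = u + (v + w)" by transfer (simp add: add.assoc)
  show "u + v = v + u" by transfer (simp add: add.commute)
  show "0 + u = u" by transfer simp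
  show "- u + u = 0" by transfer simp
  show "u - v = u + - v" by transfer simp
  show "a *\<^sub>R (u + v) = a *\<^sub>R u + a *\<^sub>R v" by transfer (simp add: scaleR_add_right)
  show "(a + b) *\<^sub>R u = a *\<^sub>R u + b *\<^sub>R u" by transfer (simp add: scaleR_add_left)
  show "a *\<^sub>R b *\<^sub>R u = (a * b) *\<^sub>R u" by transfer simp
  show "1 *\<^sub>R u = u" by transfer simp
qed

end

instantiation ell2 :: (type) real_inner
begin

lift_definition inner_ell2 :: "'a ell2 \<Rightarrow> 'a ell2 \<Rightarrow> real" is "\<lambda>f g. \<Sum>\<^sub>\<infinity>n. f n \<bullet> g n" .

definition norm_ell2 :: "'a ell2 \<Rightarrow> real" where "norm_ell2 u = sqrt (u \<bullet> u)"

definition sgn_ell2 :: "'a ell2 \<Rightarrow> 'a ell2" where "sgn_ell2 u = u /\<^sub>R norm u"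

definition dist_ell2 :: "'a ell2 \<Rightarrow> 'a ell2 \<Rightarrow> real" where "dist_ell2 u v = norm (u - v)"

definition uniformity_ell2 :: "('a ell2 \<times> 'a ell2) filter"
  where "uniformity_ell2 = (INF e\<in>{0<..}. principal {(u, v). dist u v < e})"

definition open_ell2 :: "'a ell2 set \<Rightarrow> bool"
  where "open_ell2 U \<longleftrightarrow> (\<forall>u\<in>U. \<forall>\<^sub>F (u', v) in uniformity. u' = u \<longrightarrow> v \<in> U)"

instance
proof
  fix u v w :: "'a ell2" and a :: real
  show "dist u v = norm (u - v)" by (rule dist_ell2_def)
  show "sgn u = u /\<^sub>R norm u" by (rule sgn_ell2_def)
  show "uniformity = (INF e\<in>{0<..}. principal {(u, v :: 'a ell2). dist u v < e})"
    by (rule uniformity_ell2_def)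
  show "open U \<longleftrightarrow> (\<forall>u\<in>U. \<forall>\<^sub>F (u', v) in uniformity. u' = u \<longrightarrow> v \<in> U)" for U :: "'a ell2 set"
    by (rule open_ell2_def)
  show "u \<bullet> v = v \<bullet> u" by transfer (simp add: inner_commute)
  show "(u + v) \<bullet> w = u \<bullet> w + v \<bullet> w"
    by transfer (simp add: inner_add_left infsum_add ell2_inner_summable)
  show "(a *\<^sub>R u) \<bullet> v = a * (u \<bullet> v)"
    by transfer (simp add: infsum_cmult_right')
  show "0 \<le> u \<bullet> u" by transfer (rule infsum_nonneg, simp)
  show "u \<bullet> u = 0 \<longleftrightarrow> u = 0"
  proof transfer
    fix f :: "'a \<Rightarrow> complex"
    assume f: "(\<lambda>n. (cmod (f n))\<^sup>2) summable_on UNIV"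
    show "((\<Sum>\<^sub>\<infinity>n. f n \<bullet> f n) = 0) = (f = (\<lambda>_. 0))"
    proof
      assume "(\<Sum>\<^sub>\<infinity>n. f n \<bullet> f n) = 0"
      hence "f n \<bullet> f n = 0" for n
        using nonneg_infsum_le_0D[of "\<lambda>n. f n \<bullet> f n" UNIV n] ell2_inner_summable[OF f f] by simp
      thus "f = (\<lambda>_. 0)" by auto
    qed simp
  qed
  show "norm u = sqrt (u \<bullet> u)" by (rule norm_ell2_def)
qed

end

lemma inner_eq_Re_cinner: "u \<bullet> v = Re (cinner u v)"
proof transfer
  fix f g :: "'a \<Rightarrow> complex"
  assume "(\<lambda>n. (cmod (f n))\<^sup>2) summable_on UNIV" "(\<lambda>n. (cmod (g n))\<^sup>2) summable_on UNIV"
  hence "((\<lambda>n. cnj (f n) * g n) has_sum (\<Sum>\<^sub>\<infinity>n. cnj (f n) * g n)) UNIV"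
    by (intro has_sum_infsum ell2_cinner_summable)
  hence "((\<lambda>n. Re (cnj (f n) * g n)) has_sum Re (\<Sum>\<^sub>\<infinity>n. cnj (f n) * g n)) UNIV"
    by (rule has_sum_Re)
  thus "(\<Sum>\<^sub>\<infinity>n. f n \<bullet> g n) = Re (\<Sum>\<^sub>\<infinity>n. cnj (f n) * g n)"
    by (simp add: inner_complex_def infsumI)
qed

section \<open>Operators\<close>

text \<open>Bounded operators are functions; unbounded operators are identified with their graphs,
  so that the closure of an operator is the topological closure of its graph.\<close>

definition adjoint_graph :: "('a ell2 \<times> 'a ell2) set \<Rightarrow> ('a ell2 \<times> 'a ell2) set" where
  "adjoint_graph G = {(v, w). \<forall>(u, y) \<in> G. cinner y v = cinner u w}"

definition self_adjoint :: "('a ell2 \<times> 'a ell2) set \<Rightarrow> bool" where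
  "self_adjoint G \<longleftrightarrow> closure (Domain G) = UNIV \<and> adjoint_graph G = G"

definition op_spectrum :: "('a ell2 \<Rightarrow> 'a ell2) \<Rightarrow> complex set" where
  "op_spectrum T = {z. \<not> (\<exists>R. bounded_linear R \<and>
     (\<forall>u. R (T u - cscale z u) = u) \<and> (\<forall>u. T (R u) - cscale z (R u) = u))}"

text \<open>\<open>P\<close> is the projection-valued measure of the bounded self-adjoint operator \<open>T\<close>
  (it exists and is unique by the spectral theorem), so that \<open>P B\<close> is the spectral projection
  \<open>1\<^sub>B(T)\<close> for each Borel set \<open>B\<close>. The last clause says
  \<open>\<langle>u, T u\<rangle> = \<integral> \<lambda> d\<langle>u, P u\<rangle>\<close>, where \<open>\<langle>u, P B u\<rangle> = \<parallel>P B u\<parallel>\<^sup>2\<close>.\<close>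

definition spectral_measure ::
  "('a ell2 \<Rightarrow> 'a ell2) \<Rightarrow> (real set \<Rightarrow> 'a ell2 \<Rightarrow> 'a ell2) \<Rightarrow> bool" where
  "spectral_measure T P \<longleftrightarrow>
     (\<forall>B \<in> sets borel. bounded_linear (P B) \<and> (\<forall>u. P B (P B u) = P B u) \<and>
        (\<forall>u v. cinner (P B u) v = cinner u (P B v))) \<and>
     (\<forall>u. P UNIV u = u) \<and>
     (\<forall>B :: nat \<Rightarrow> real set. range B \<subseteq> sets borel \<longrightarrow> disjoint_family B \<longrightarrow>
        (\<forall>u. (\<lambda>k. P (B k) u) sums P (\<Union>k. B k) u)) \<and>
     (\<forall>u. let M = measure_of UNIV (sets borel) (\<lambda>B. ennreal ((norm (P B u))\<^sup>2)) in
        integrable M (\<lambda>x. x) \<and> cinner u (T u) = complex_of_real (\<integral>x. x \<partial>M))"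

text \<open>The form order; it is only used for self-adjoint operators, whose forms are real.\<close>

definition op_le :: "('a ell2 \<Rightarrow> 'a ell2) \<Rightarrow> ('a ell2 \<Rightarrow> 'a ell2) \<Rightarrow> bool" where
  "op_le S T \<longleftrightarrow> (\<forall>u. u \<bullet> S u \<le> u \<bullet> T u)"

section \<open>The discrete Laplacian and the conjugate operators\<close>

type_synonym site = "int ^ 2"

definition shift_seq :: "2 \<Rightarrow> int \<Rightarrow> (site \<Rightarrow> complex) \<Rightarrow> (site \<Rightarrow> complex)" where
  "shift_seq i k f = (\<lambda>n. f (n - axis i k))"

text \<open>\<open>shift i k\<close> is \<open>S\<^sub>i\<^sup>k\<close>; in particular \<open>shift i (- 1)\<close> is the adjoint of \<open>S\<^sub>i\<close>.\<close>

lift_definition shift :: "2 \<Rightarrow> int \<Rightarrow> site ell2 \<Rightarrow> site ell2" is shift_seq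
proof -
  fix i :: 2 and k :: int and f :: "site \<Rightarrow> complex"
  assume "(\<lambda>n. (cmod (f n))\<^sup>2) summable_on UNIV"
  moreover have "bij_betw (\<lambda>n :: site. n - axis i k) UNIV UNIV"
    by (rule bij_betw_byWitness[where f' = "\<lambda>n. n + axis i k"]) auto
  ultimately show "(\<lambda>n. (cmod (shift_seq i k f n))\<^sup>2) summable_on UNIV"
    using summable_on_reindex_bij_betw[of "\<lambda>n :: site. n - axis i k" UNIV UNIV
        "\<lambda>n. (cmod (f n))\<^sup>2"]
    by (simp add: shift_seq_def)
qed

definition Laplacian :: "site ell2 \<Rightarrow> site ell2" ("\<Delta>") where
  "\<Delta> u = (\<Sum>i\<in>UNIV. (1/2) *\<^sub>R (shift i 1 u + shift i (- 1) u))"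

definition compactly_supported :: "site ell2 set" where
  "compactly_supported = {u. finite {n. seq u n \<noteq> 0}}"

definition position_seq :: "2 \<Rightarrow> (site \<Rightarrow> complex) \<Rightarrow> (site \<Rightarrow> complex)" where
  "position_seq i f = (\<lambda>n. of_int (n $ i) * f n)"

definition conj_seq :: "2 \<Rightarrow> nat \<Rightarrow> nat \<Rightarrow> (site \<Rightarrow> complex) \<Rightarrow> (site \<Rightarrow> complex)" where
  "conj_seq i j \<kappa> f =
     (let D = (\<lambda>h n. shift_seq i (int (j * \<kappa>)) h n - shift_seq i (- int (j * \<kappa>)) h n)
      in (\<lambda>n. 1 / (4 * \<i>) * (D (position_seq i f) n + position_seq i (D f) n)))"

definition conj_coord :: "2 \<Rightarrow> nat \<Rightarrow> nat \<Rightarrow> (site ell2 \<times> site ell2) set" where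
  "conj_coord i j \<kappa> =
     closure {(u, v). u \<in> compactly_supported \<and> seq v = conj_seq i j \<kappa> (seq u)}"

text \<open>The sum over \<open>i\<close> of the closed operators, on the intersection of their domains, is only
  essentially self-adjoint; the self-adjoint operator \<open>A\<^sub>j\<^sub>\<kappa>\<close> is its closure.\<close>

definition conj_op :: "nat \<Rightarrow> nat \<Rightarrow> (site ell2 \<times> site ell2) set" where
  "conj_op j \<kappa> = closure {(u, \<Sum>i\<in>UNIV. w i) | u w. \<forall>i. (u, w i) \<in> conj_coord i j \<kappa>}"

text \<open>The coefficient \<open>\<rho> j\<close> stands for \<open>\<rho>\<^sub>j\<^sub>\<kappa>\<close>, \<open>j \<ge> 1\<close>. The domain consists of the \<open>u\<close> in
  the domains of all \<open>A\<^sub>j\<^sub>\<kappa>\<close> that occur for which the series converges in norm.\<close>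

definition linear_combination :: "nat \<Rightarrow> (nat \<Rightarrow> real) \<Rightarrow> (site ell2 \<times> site ell2) set" where
  "linear_combination \<kappa> \<rho> = {(u, v). \<exists>w.
     (\<forall>j\<ge>1. \<rho> j \<noteq> 0 \<longrightarrow> (u, w j) \<in> conj_op j \<kappa>) \<and>
     (\<lambda>j. \<rho> (Suc j) *\<^sub>R w (Suc j)) sums v}"

definition conjugate_operator :: "nat \<Rightarrow> (site ell2 \<times> site ell2) set \<Rightarrow> bool" where
  "conjugate_operator \<kappa> \<A> \<longleftrightarrow> (\<exists>\<rho>.
     compactly_supported \<subseteq> Domain (linear_combination \<kappa> \<rho>) \<and>
     \<A> = closure (linear_combination \<kappa> \<rho>) \<and> self_adjoint \<A>)"

text \<open>\<open>C\<close> is the bounded extension of the commutator \<open>[\<Delta>, \<i>\<A>]\<close> from the dense, \<open>\<Delta>\<close>-invariant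
  subspace of compactly supported sequences.\<close>

definition bounded_commutator ::
  "(site ell2 \<times> site ell2) set \<Rightarrow> (site ell2 \<Rightarrow> site ell2) \<Rightarrow> bool" where
  "bounded_commutator \<A> C \<longleftrightarrow> bounded_linear C \<and>
     (\<forall>u\<in>compactly_supported. \<forall>v w. (u, v) \<in> \<A> \<longrightarrow> (\<Delta> u, w) \<in> \<A> \<longrightarrow>
        C u = \<Delta> (cscale \<i> v) - cscale \<i> w)"

definition spectrum_Laplacian :: "real set" ("\<sigma>\<Delta>") where
  "\<sigma>\<Delta> = {E. complex_of_real E \<in> op_spectrum \<Delta>}"

definition mu_set :: "nat \<Rightarrow> real set" where
  "mu_set \<kappa> = {E \<in> \<sigma>\<Delta>. \<exists>\<A> C P I \<gamma>.
     conjugate_operator \<kappa> \<A> \<and> bounded_commutator \<A> C \<and> spectral_measure \<Delta> P \<and>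
     open I \<and> is_interval I \<and> E \<in> I \<and> \<gamma> > 0 \<and>
     op_le (\<lambda>u. \<gamma> *\<^sub>R P I u) (\<lambda>u. P I (C (P I u)))}"

definition Theta :: "nat \<Rightarrow> real set" where
  "Theta \<kappa> = \<sigma>\<Delta> - mu_set \<kappa>"

section \<open>The threshold sets of finite order\<close>

text \<open>Chebyshev polynomials of the second kind.\<close>

fun cheb_U :: "nat \<Rightarrow> real \<Rightarrow> real" where
  "cheb_U 0 x = 1"
| "cheb_U (Suc 0) x = 2 * x"
| "cheb_U (Suc (Suc n)) x = 2 * x * cheb_U (Suc n) x - cheb_U n x"

definition g_fun :: "nat \<Rightarrow> nat \<Rightarrow> real ^ 2 \<Rightarrow> real" where
  "g_fun j \<kappa> x = (\<Sum>i\<in>UNIV. (1 - (x $ i)\<^sup>2) * cheb_U (j * \<kappa> - 1) (x $ i))"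

definition const_energy_surface :: "real \<Rightarrow> (real ^ 2) set" where
  "const_energy_surface E = {x. (\<forall>i. x $ i \<in> {-1..1}) \<and> (\<Sum>i\<in>UNIV. x $ i) = E}"

definition Theta_fin :: "nat \<Rightarrow> nat \<Rightarrow> real set" where
  "Theta_fin m \<kappa> = {E \<in> \<sigma>\<Delta>. \<exists>(x :: nat \<Rightarrow> real ^ 2) (\<omega> :: nat \<Rightarrow> real).
     (\<forall>q\<le>m. x q \<in> const_energy_surface E) \<and> (\<forall>q<m. \<omega> q \<le> 0) \<and>
     (\<forall>j\<ge>1. g_fun j \<kappa> (x m) = (\<Sum>q<m. \<omega> q * g_fun j \<kappa> (x q)))}"

definition J2 :: "nat \<Rightarrow> real set" where
  "J2 \<kappa> = {2 * cos (pi / \<kappa>) <..< 1 + cos (pi / \<kappa>)}"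

end

theory Submission
  imports Defs
begin

text \<open>
  The proof has two halves. The first shows that every element of \<open>Theta_fin m \<kappa>\<close> is
  a threshold, the second constructs elements of \<open>Theta_fin n \<kappa>\<close> that decrease to
  \<open>2 * cos (pi / \<kappa>)\<close>.

  \<^bold>\<open>Finite-order energies are thresholds.\<close> In momentum space the commutator of \<open>\<Delta>\<close> with
  \<open>\<i> \<Sum>\<^sub>j \<rho>\<^sub>j A\<^sub>j\<^sub>\<kappa>\<close> is multiplication by \<open>G = \<Sum>\<^sub>j \<rho>\<^sub>j g\<^sub>j\<^sub>\<kappa>\<close>, in the variables
  \<open>x\<^sub>i = cos \<theta>\<^sub>i\<close>. The series is harmless: applying \<open>\<Sum>\<^sub>j \<rho>\<^sub>j A\<^sub>j\<^sub>\<kappa>\<close> to the unit vector at the origin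
  gives a square-summable sequence whose values include \<open>j \<rho>\<^sub>j\<close> up to a constant, so
  \<open>\<Sum>\<^sub>j \<bar>\<rho>\<^sub>j\<bar> < \<infinity>\<close> (\<open>linear_combination_coeffs_summable\<close>). Plane waves truncated to large
  boxes are approximate eigenvectors of all the shifts at once. At a point of the surface
  \<open>x\<^sub>1 + x\<^sub>2 = E\<close> they are therefore approximate eigenvectors of \<open>\<Delta>\<close> at \<open>E\<close>, so the
  projection \<open>1\<^sub>I(\<Delta>)\<close> fixes them up to a small error (\<open>spectral_localization\<close>), and a strict
  Mourre estimate forces \<open>G \<ge> \<gamma>\<close> on the whole surface (\<open>mourre_localized\<close>). A relation
  \<open>g\<^sub>j\<^sub>\<kappa>(x\<^sub>m) = \<Sum>\<^sub>q \<omega>\<^sub>q g\<^sub>j\<^sub>\<kappa>(x\<^sub>q)\<close> with all \<open>\<omega>\<^sub>q \<le> 0\<close> passes to \<open>G\<close> and gives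
  \<open>G(x\<^sub>m) \<le> 0\<close>, a contradiction (\<open>Theta_fin_subset_Theta\<close>).

  \<^bold>\<open>Construction of the energies.\<close> With \<open>x = cos t\<close>, one coordinate contributes
  \<open>h\<^sub>j(x) = sin t * sin (j \<kappa> t)\<close> to \<open>g\<^sub>j\<^sub>\<kappa>\<close>. Put \<open>c = cos (pi / \<kappa>)\<close>. The reflection
  \<open>t \<mapsto> 2 * pi / \<kappa> - t\<close> fixes the angle of \<open>c\<close>, where all \<open>h\<^sub>j\<close> vanish, and multiplies all \<open>h\<^sub>j\<close> by one and the
  same nonpositive factor. Start at the point \<open>(1, E - 1)\<close> of the surface. Again and again reflect
  the second coordinate and take the result as first coordinate of the next point of the surface.
  The new term is a nonpositive multiple of the old one, and this alternation yields the signs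
  \<open>\<omega>\<^sub>q \<le> 0\<close>. It closes up after \<open>n\<close> steps if the last second coordinate is \<open>c\<close> (its
  contribution vanishes) or \<open>E / 2\<close> (it equals the first coordinate); both make \<open>E\<close> an element of
  \<open>Theta_fin n \<kappa>\<close> (\<open>chain_Theta_fin\<close>). By the intermediate value theorem energies of the two kinds
  exist for every \<open>n\<close> and interlace (\<open>hits_next\<close>). Every step of the chain moves right by at least
  \<open>E - 2 * c\<close>, and a chain that ends at \<open>c\<close> never exceeds \<open>c\<close>, so \<open>E - 2 * c\<close> is of order \<open>1 / n\<close> (\<open>hits_fold_rate\<close>).
\<close>

section \<open>Coordinates in the sequence space\<close>

lemma axis_arith [simp]:
  "axis i (- a) = - axis i (a :: int)" "axis i (a + b) = axis i a + axis i b"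
  "axis i (a - b) = axis i a - axis i b" "axis i a $ j = (if j = i then a else 0)"
  by (auto simp: vec_eq_iff axis_def)

lemma seq_simps [simp]:
  "seq (u + v) n = seq u n + seq v n" "seq (u - v) n = seq u n - seq v n" "seq 0 n = 0"
  "seq (r *\<^sub>R u) n = r *\<^sub>R seq u n" "seq (cscale z u) n = z * seq u n"
  "seq (shift i k w) m = seq w (m - axis i k)"
  by (simp_all add: plus_ell2.rep_eq minus_ell2.rep_eq zero_ell2.rep_eq scaleR_ell2.rep_eq
      cscale.rep_eq shift.rep_eq shift_seq_def)

lemma ell2_eqI: "(\<And>n. seq u n = seq v n) \<Longrightarrow> u = v"
  by (simp add: seq_inject[symmetric] fun_eq_iff)

lemma seq_summable: "(\<lambda>n. (cmod (seq u n))\<^sup>2) summable_on UNIV"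
  using seq[of u] by simp

lemma norm_ell2_sq: "(norm u)\<^sup>2 = (\<Sum>\<^sub>\<infinity>n. (cmod (seq u n))\<^sup>2)"
proof -
  have "(norm u)\<^sup>2 = u \<bullet> u" by (rule power2_norm_eq_inner)
  also have "\<dots> = (\<Sum>\<^sub>\<infinity>n. (cmod (seq u n))\<^sup>2)"
    by transfer (simp add: power2_norm_eq_inner)
  finally show ?thesis .
qed

lemma norm_seq_le: "cmod (seq u n) \<le> norm u"
proof -
  have "(\<Sum>m\<in>{n}. (cmod (seq u m))\<^sup>2) \<le> (norm u)\<^sup>2"
    unfolding norm_ell2_sq by (rule finite_sum_le_infsum[OF seq_summable]) auto
  thus ?thesis by (simp add: abs_le_square_iff[symmetric])
qed

lemma
  fixes f :: "'a \<Rightarrow> complex"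
  assumes D: "finite D" and f: "\<And>n. n \<notin> D \<Longrightarrow> f n = 0"
  shows finite_support_summable: "(\<lambda>n. (cmod (f n))\<^sup>2) summable_on UNIV"
    and finite_support_infsum: "(\<Sum>\<^sub>\<infinity>n. (cmod (f n))\<^sup>2) = (\<Sum>n\<in>D. (cmod (f n))\<^sup>2)"
proof -
  have "((\<lambda>n. (cmod (f n))\<^sup>2) has_sum (\<Sum>n\<in>D. (cmod (f n))\<^sup>2)) UNIV"
    using has_sum_cong_neutral[of UNIV D "\<lambda>n. (cmod (f n))\<^sup>2" "\<lambda>n. (cmod (f n))\<^sup>2"]
      has_sum_finite[OF D, of "\<lambda>n. (cmod (f n))\<^sup>2"] f by auto
  thus "(\<lambda>n. (cmod (f n))\<^sup>2) summable_on UNIV"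
    "(\<Sum>\<^sub>\<infinity>n. (cmod (f n))\<^sup>2) = (\<Sum>n\<in>D. (cmod (f n))\<^sup>2)"
    by (auto simp: summable_on_def infsumI)
qed

lemma bounded_linear_seq: "bounded_linear (\<lambda>u. seq u n)"
  by (rule bounded_linear_intro[where K = 1]) (auto simp: norm_seq_le)

lemma norm_cscale: "norm (cscale z u) = cmod z * norm u"
proof -
  have "(norm (cscale z u))\<^sup>2 = (cmod z * norm u)\<^sup>2"
    by (simp add: norm_ell2_sq norm_mult power_mult_distrib infsum_cmult_right')
  thus ?thesis by simp
qed

lemma bounded_linear_cscale: "bounded_linear (cscale z)"
  by (rule bounded_linear_intro[where K = "cmod z"])
    (auto intro!: ell2_eqI simp: norm_cscale algebra_simps)

lemma norm_shift: "norm (shift i k u) = norm u"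
proof -
  have "bij_betw (\<lambda>n :: site. n - axis i k) UNIV UNIV"
    by (rule bij_betw_byWitness[where f' = "\<lambda>n. n + axis i k"]) auto
  hence "(\<Sum>\<^sub>\<infinity>n. (cmod (seq u (n - axis i k)))\<^sup>2) = (\<Sum>\<^sub>\<infinity>n. (cmod (seq u n))\<^sup>2)"
    by (rule infsum_reindex_bij_betw)
  hence "(norm (shift i k u))\<^sup>2 = (norm u)\<^sup>2" by (simp add: norm_ell2_sq)
  thus ?thesis by simp
qed

lemma bounded_linear_shift: "bounded_linear (shift i k)"
  by (rule bounded_linear_intro[where K = 1]) (auto intro!: ell2_eqI simp: norm_shift)

lemma bounded_linear_Laplacian: "bounded_linear \<Delta>"
  unfolding Laplacian_def
  by (intro bounded_linear_sum bounded_linear_compose[OF bounded_linear_scaleR_right]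
      bounded_linear_add bounded_linear_shift)

lemma seq_Laplacian: "seq (\<Delta> u) n =
  (seq u (n - axis 1 1) + seq u (n + axis 1 1) + seq u (n - axis 2 1) + seq u (n + axis 2 1)) / 2"
  by (simp add: Laplacian_def sum_2 scaleR_conv_of_real algebra_simps)

lemma cinner_seq: "cinner u v = (\<Sum>\<^sub>\<infinity>n. cnj (seq u n) * seq v n)"
  by (rule cinner.rep_eq)

lemma cinner_shift: "cinner (shift i k u) v = cinner u (shift i (- k) v)"
proof -
  have "bij_betw (\<lambda>n :: site. n - axis i k) UNIV UNIV"
    by (rule bij_betw_byWitness[where f' = "\<lambda>n. n + axis i k"]) auto
  hence "(\<Sum>\<^sub>\<infinity>n. cnj (seq u (n - axis i k)) * seq v ((n - axis i k) + axis i k))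
       = (\<Sum>\<^sub>\<infinity>n. cnj (seq u n) * seq v (n + axis i k))"
    by (rule infsum_reindex_bij_betw)
  thus ?thesis by (simp add: cinner_seq)
qed

lemma Laplacian_symmetric: "\<Delta> u \<bullet> v = u \<bullet> \<Delta> v"
proof -
  have "shift i 1 u \<bullet> v = u \<bullet> shift i (- 1) v" "shift i (- 1) u \<bullet> v = u \<bullet> shift i 1 v" for i
    using cinner_shift[of i 1 u v] cinner_shift[of i "- 1" u v] by (simp_all add: inner_eq_Re_cinner)
  thus ?thesis by (simp add: Laplacian_def sum_2 inner_add_left inner_add_right add.commute)
qed

lemma compactly_supported_Laplacian:
  assumes "u \<in> compactly_supported"
  shows "\<Delta> u \<in> compactly_supported"
proof -
  let ?S = "{n. seq u n \<noteq> 0}"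
  have "{n. seq (\<Delta> u) n \<noteq> 0} \<subseteq> (\<lambda>n. n + axis 1 1) ` ?S \<union> (\<lambda>n. n - axis 1 1) ` ?S
      \<union> (\<lambda>n. n + axis 2 1) ` ?S \<union> (\<lambda>n. n - axis 2 1) ` ?S"
  proof
    fix n assume "n \<in> {n. seq (\<Delta> u) n \<noteq> 0}"
    hence "seq u (n - axis 1 1) \<noteq> 0 \<or> seq u (n + axis 1 1) \<noteq> 0 \<or>
      seq u (n - axis 2 1) \<noteq> 0 \<or> seq u (n + axis 2 1) \<noteq> 0" by (auto simp: seq_Laplacian)
    moreover have "n \<in> (\<lambda>n. n + a) ` ?S" if "seq u (n - a) \<noteq> 0" for a
      using that by (intro image_eqI[of _ _ "n - a"]) auto
    moreover have "n \<in> (\<lambda>n. n - a) ` ?S" if "seq u (n + a) \<noteq> 0" for a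
      using that by (intro image_eqI[of _ _ "n + a"]) auto
    ultimately show "n \<in> (\<lambda>n. n + axis 1 1) ` ?S \<union> (\<lambda>n. n - axis 1 1) ` ?S
      \<union> (\<lambda>n. n + axis 2 1) ` ?S \<union> (\<lambda>n. n - axis 2 1) ` ?S" by blast
  qed
  thus ?thesis using assms
    by (auto simp: compactly_supported_def intro: finite_subset)
qed

section \<open>The commutator with a conjugate operator\<close>

lemma conj_seq_eq: "conj_seq i j \<kappa> f n =
  1 / (4 * \<i>) * (of_int (2 * n $ i - int (j * \<kappa>)) * f (n - axis i (int (j * \<kappa>)))
    - of_int (2 * n $ i + int (j * \<kappa>)) * f (n + axis i (int (j * \<kappa>))))"
  by (simp add: conj_seq_def shift_seq_def position_seq_def Let_def)
    (simp add: add_divide_distrib diff_divide_distrib algebra_simps)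

text \<open>Each coordinate of the image under \<open>A\<^sub>i(j, \<kappa>)\<close> depends on two coordinates of the argument only,
hence continuously on the argument. So the pointwise formula survives the passage to closures,
although the operator is unbounded.\<close>

lemma closed_conj_graph: "closed {(u :: site ell2, v :: site ell2). \<forall>n. seq v n = (\<Sum>i\<in>I. conj_seq i j \<kappa> (seq u) n)}"
proof -
  have "{(u, v). \<forall>n. seq v n = (\<Sum>i\<in>I. conj_seq i j \<kappa> (seq u) n)} =
    (\<Inter>n. {p. seq (snd p) n = (\<Sum>i\<in>I. conj_seq i j \<kappa> (seq (fst p)) n)})" by auto
  moreover have "closed {p :: site ell2 \<times> site ell2. seq (snd p) n = (\<Sum>i\<in>I. conj_seq i j \<kappa> (seq (fst p)) n)}" for n
    unfolding conj_seq_eq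
    by (intro closed_Collect_eq continuous_intros
        bounded_linear.continuous_on[OF bounded_linear_seq])
  ultimately show ?thesis by auto
qed

lemma conj_op_seq:
  assumes "(u, v) \<in> conj_op j \<kappa>"
  shows "seq v n = (\<Sum>i\<in>UNIV. conj_seq i j \<kappa> (seq u) n)"
proof -
  have coord: "seq w n = conj_seq i j \<kappa> (seq u) n" if "(u, w) \<in> conj_coord i j \<kappa>" for u w i n
  proof -
    have "conj_coord i j \<kappa> \<subseteq> {(u, v). \<forall>n. seq v n = (\<Sum>i\<in>{i}. conj_seq i j \<kappa> (seq u) n)}"
      unfolding conj_coord_def by (rule closure_minimal[OF _ closed_conj_graph]) auto
    thus ?thesis using that by auto
  qed
  have "conj_op j \<kappa> \<subseteq> {(u, v). \<forall>n. seq v n = (\<Sum>i\<in>UNIV. conj_seq i j \<kappa> (seq u) n)}"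
    unfolding conj_op_def
    by (rule closure_minimal[OF _ closed_conj_graph]) (auto simp: sum_2 intro!: arg_cong2[where f = plus] coord)
  thus ?thesis using assms by auto
qed

text \<open>With \<open>k = j * \<kappa>\<close> this is the commutator \<open>[\<Delta>, \<i> A\<^sub>j\<^sub>\<kappa>]\<close>, namely
\<open>- \<Sum>\<^sub>i (S\<^sub>i\<^sup>k - S\<^sub>i\<^sup>-\<^sup>k) (S\<^sub>i - S\<^sub>i\<^sup>-\<^sup>1) / 4\<close> multiplied out.\<close>

definition commutator_term :: "nat \<Rightarrow> site ell2 \<Rightarrow> site ell2" where
  "commutator_term k u = (\<Sum>i\<in>UNIV. (1/4) *\<^sub>R (shift i (int k - 1) u + shift i (1 - int k) u
     - shift i (int k + 1) u - shift i (- int k - 1) u))"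

lemma norm_commutator_term: "norm (commutator_term k u) \<le> 2 * norm u"
proof -
  have "norm (a + b - c - d) \<le> norm a + norm b + norm c + norm d" for a b c d :: "site ell2"
    by norm
  note * = this[of "shift i (int k - 1) u" "shift i (1 - int k) u" "shift i (int k + 1) u"
      "shift i (- int k - 1) u" for i]
  show ?thesis
    unfolding commutator_term_def sum_2
    by (rule order_trans[OF norm_triangle_ineq]) (use *[of 1] *[of 2] in \<open>simp add: norm_shift\<close>)
qed

lemma commutator_conj_op:
  assumes "(u, w) \<in> conj_op j \<kappa>" "(\<Delta> u, w') \<in> conj_op j \<kappa>"
  shows "\<Delta> (cscale \<i> w) - cscale \<i> w' = commutator_term (j * \<kappa>) u"
proof (rule ell2_eqI)
  fix n
  note s = conj_op_seq[OF assms(1)] conj_op_seq[OF assms(2)]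
  define k where "k = int (j * \<kappa>)"
  have C: "(1 :: 2) \<noteq> 2" "(2 :: 2) \<noteq> 1" by auto
  show "seq (\<Delta> (cscale \<i> w) - cscale \<i> w') n = seq (commutator_term (j * \<kappa>) u) n"
    by (simp add: s seq_Laplacian sum_2 conj_seq_eq commutator_term_def k_def[symmetric] C del: of_nat_mult)
      (simp add: scaleR_conv_of_real add_divide_distrib diff_divide_distrib algebra_simps)
qed

lemma conjugate_operator_cases:
  assumes "conjugate_operator \<kappa> \<A>"
  obtains \<rho> where "linear_combination \<kappa> \<rho> \<subseteq> \<A>"
    "compactly_supported \<subseteq> Domain (linear_combination \<kappa> \<rho>)"
  using assms closure_subset unfolding conjugate_operator_def by metis

text \<open>This is the Cauchy-Schwarz inequality for \<open>j r\<^sub>j\<close> and \<open>1 / j\<close>, in the form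
\<open>2 a b \<le> a\<^sup>2 + b\<^sup>2\<close>.\<close>

lemma summable_of_square_weighted:
  fixes r :: "nat \<Rightarrow> real"
  assumes "summable (\<lambda>j. (r j * real (Suc j))\<^sup>2)"
  shows "summable (\<lambda>j. \<bar>r j\<bar>)"
proof (rule summable_comparison_test)
  have "summable (\<lambda>j. (1 / real (Suc j))\<^sup>2)"
    using inverse_power_summable[of 2, where ?'a = real]
    by (subst summable_Suc_iff[where f = "\<lambda>j. (1 / real j)\<^sup>2"]) (simp add: power_divide divide_inverse power_inverse)
  thus "summable (\<lambda>j. (r j * real (Suc j))\<^sup>2 + (1 / real (Suc j))\<^sup>2)"
    using assms by (intro summable_add)
  have "\<bar>r j\<bar> \<le> (r j * real (Suc j))\<^sup>2 + (1 / real (Suc j))\<^sup>2" for j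
  proof -
    have "\<bar>r j\<bar> = \<bar>r j * real (Suc j)\<bar> * (1 / real (Suc j))" by (simp add: abs_mult)
    also have "2 * \<dots> \<le> \<bar>r j * real (Suc j)\<bar>\<^sup>2 + (1 / real (Suc j))\<^sup>2"
      using sum_squares_bound[of "\<bar>r j * real (Suc j)\<bar>" "1 / real (Suc j)"] by (simp add: mult.assoc)
    finally show ?thesis using abs_ge_zero[of "r j"] by simp
  qed
  thus "\<exists>N. \<forall>j\<ge>N. norm \<bar>r j\<bar> \<le> (r j * real (Suc j))\<^sup>2 + (1 / real (Suc j))\<^sup>2" by auto
qed

definition delta0 :: "site ell2" where
  "delta0 = Abs_ell2 (\<lambda>n. if n = 0 then 1 else 0)"

lemma seq_delta0: "seq delta0 n = (if n = 0 then 1 else 0)"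
proof -
  have "(\<lambda>n :: site. (cmod (if n = 0 then 1 else 0))\<^sup>2) summable_on UNIV"
    by (rule finite_support_summable[of "{0}"]) auto
  thus ?thesis unfolding delta0_def by (subst Abs_ell2_inverse) auto
qed

lemma delta0_compactly_supported: "delta0 \<in> compactly_supported"
proof -
  have "{n. seq delta0 n \<noteq> 0} = {0}" by (auto simp: seq_delta0)
  thus ?thesis by (simp add: compactly_supported_def)
qed

text \<open>The image of the unit vector at the origin under \<open>\<Sum>\<^sub>j \<rho>\<^sub>j A\<^sub>j\<^sub>\<kappa>\<close> has the value
\<open>j \<kappa> \<rho>\<^sub>j / (4 \<i>)\<close> at the site \<open>j \<kappa> e\<^sub>1\<close>, because no other \<open>A\<^sub>l\<^sub>\<kappa>\<close> reaches that site from the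
origin. Square summability of the image controls the weighted coefficients.\<close>

lemma linear_combination_coeffs_summable:
  assumes \<kappa>: "\<kappa> \<ge> 1" and dom: "delta0 \<in> Domain (linear_combination \<kappa> \<rho>)"
  shows "summable (\<lambda>j. \<bar>\<rho> (Suc j)\<bar>)"
proof -
  obtain v w where w: "\<And>j. j \<ge> 1 \<Longrightarrow> \<rho> j \<noteq> 0 \<Longrightarrow> (delta0, w j) \<in> conj_op j \<kappa>"
    and v: "(\<lambda>j. \<rho> (Suc j) *\<^sub>R w (Suc j)) sums v"
    using dom unfolding linear_combination_def by blast
  define p :: "nat \<Rightarrow> site" where "p m = axis 1 (int (Suc m * \<kappa>))" for m
  have inj: "inj p"
  proof (rule injI)
    fix m m' assume "p m = p m'"
    hence "p m $ 1 = p m' $ 1" by simp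
    thus "m = m'" using \<kappa> by (simp add: p_def)
  qed
  have coord: "\<rho> (Suc j) *\<^sub>R seq (w (Suc j)) (p m)
     = (if j = m then of_real (\<rho> (Suc m) * real (Suc m * \<kappa>)) / (4 * \<i>) else 0)" for j m
  proof (cases "\<rho> (Suc j) = 0")
    case False
    define a where "a = int (Suc j * \<kappa>)"
    define b where "b = int (Suc m * \<kappa>)"
    have ab: "a > 0" "b > 0" "a = b \<longleftrightarrow> j = m" using \<kappa> by (auto simp: a_def b_def simp del: of_nat_mult)
    have C: "(1 :: 2) \<noteq> 2" "(2 :: 2) \<noteq> 1" by auto
    have "axis 1 b - axis 1 a = (0 :: site) \<longleftrightarrow> a = b" "axis 1 b + axis 1 a \<noteq> (0 :: site)"
      "axis 1 b - axis 2 a \<noteq> (0 :: site)" "axis 1 b + axis 2 a \<noteq> (0 :: site)"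
      using ab C by (auto simp: vec_eq_iff forall_2)
    note axes = this
    have "seq (w (Suc j)) (p m) = (\<Sum>i\<in>UNIV. conj_seq i (Suc j) \<kappa> (seq delta0) (p m))"
      by (rule conj_op_seq[OF w]) (use False in auto)
    also have "\<dots> = (if a = b then of_int a / (4 * \<i>) else 0)"
      unfolding conj_seq_eq p_def a_def[symmetric] b_def[symmetric] seq_delta0
      using axes C by (auto simp: sum_2)
    finally have "seq (w (Suc j)) (p m) = (if a = b then of_int a / (4 * \<i>) else 0)" .
    thus ?thesis using ab by (auto simp: scaleR_conv_of_real a_def b_def)
  qed auto
  have "seq v (p m) = of_real (\<rho> (Suc m) * real (Suc m * \<kappa>)) / (4 * \<i>)" for m
  proof -
    have "(\<lambda>j. seq (\<rho> (Suc j) *\<^sub>R w (Suc j)) (p m)) sums seq v (p m)"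
      by (rule bounded_linear.sums[OF bounded_linear_seq v])
    hence "(\<lambda>j. if j = m then of_real (\<rho> (Suc m) * real (Suc m * \<kappa>)) / (4 * \<i>) else 0) sums seq v (p m)"
      by (simp only: seq_simps coord)
    from sums_unique2[OF this sums_single] show ?thesis .
  qed
  note sv = this
  have "cmod (seq v (p m)) = \<bar>\<rho> (Suc m) * real (Suc m * \<kappa>)\<bar> / 4" for m
    unfolding sv norm_divide norm_of_real by (simp add: norm_mult)
  hence sq: "(cmod (seq v (p m)))\<^sup>2 = (real \<kappa> / 4)\<^sup>2 * (\<rho> (Suc m) * real (Suc m))\<^sup>2" for m
    by (simp only: power_divide power2_abs power_mult_distrib of_nat_mult) (simp add: mult_ac)
  have "(\<lambda>n. (cmod (seq v n))\<^sup>2) summable_on range p"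
    by (rule summable_on_subset_banach[OF seq_summable]) auto
  hence "(\<lambda>m. (cmod (seq v (p m)))\<^sup>2) summable_on UNIV"
    using summable_on_reindex[OF inj, of "\<lambda>n. (cmod (seq v n))\<^sup>2"] by (simp add: o_def)
  hence "summable (\<lambda>m. (real \<kappa> / 4)\<^sup>2 * (\<rho> (Suc m) * real (Suc m))\<^sup>2)"
    unfolding sq by (rule summable_on_UNIV_nonneg_real_iff[THEN iffD1, rotated]) auto
  hence "summable (\<lambda>m. (\<rho> (Suc m) * real (Suc m))\<^sup>2)"
    using \<kappa> by (subst (asm) summable_cmult_iff) auto
  thus ?thesis by (rule summable_of_square_weighted)
qed

text \<open>The series for the conjugate operator converges at \<open>u\<close> and at \<open>\<Delta> u\<close>, and \<open>\<Delta>\<close> is bounded, so the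
commutator may be taken term by term.\<close>

lemma commutator_sums:
  assumes "linear_combination \<kappa> \<rho> \<subseteq> \<A>" "compactly_supported \<subseteq> Domain (linear_combination \<kappa> \<rho>)"
    and C: "bounded_commutator \<A> C" and u: "u \<in> compactly_supported"
  shows "(\<lambda>j. \<rho> (Suc j) *\<^sub>R commutator_term (Suc j * \<kappa>) u) sums C u"
proof -
  have "\<exists>v w. (u, v) \<in> linear_combination \<kappa> \<rho> \<and> (\<forall>j\<ge>1. \<rho> j \<noteq> 0 \<longrightarrow> (u, w j) \<in> conj_op j \<kappa>) \<and>
     (\<lambda>j. \<rho> (Suc j) *\<^sub>R w (Suc j)) sums v" if "u \<in> compactly_supported" for u
  proof -
    from that assms(2) obtain v where v: "(u, v) \<in> linear_combination \<kappa> \<rho>" by blast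
    thus ?thesis unfolding linear_combination_def by blast
  qed
  from this[OF u] this[OF compactly_supported_Laplacian[OF u]] obtain v w v' w' where
    v: "(u, v) \<in> linear_combination \<kappa> \<rho>" "\<And>j. j \<ge> 1 \<Longrightarrow> \<rho> j \<noteq> 0 \<Longrightarrow> (u, w j) \<in> conj_op j \<kappa>"
      "(\<lambda>j. \<rho> (Suc j) *\<^sub>R w (Suc j)) sums v"
    and v': "(\<Delta> u, v') \<in> linear_combination \<kappa> \<rho>"
      "\<And>j. j \<ge> 1 \<Longrightarrow> \<rho> j \<noteq> 0 \<Longrightarrow> (\<Delta> u, w' j) \<in> conj_op j \<kappa>"
      "(\<lambda>j. \<rho> (Suc j) *\<^sub>R w' (Suc j)) sums v'" by blast
  have Cu: "C u = \<Delta> (cscale \<i> v) - cscale \<i> v'"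
    using C u v(1) v'(1) assms(1) unfolding bounded_commutator_def by blast
  have lin: "bounded_linear (\<lambda>v. \<Delta> (cscale \<i> v))"
    by (rule bounded_linear_compose[OF bounded_linear_Laplacian bounded_linear_cscale])
  have "(\<lambda>j. \<Delta> (cscale \<i> (\<rho> (Suc j) *\<^sub>R w (Suc j))) - cscale \<i> (\<rho> (Suc j) *\<^sub>R w' (Suc j))) sums C u"
    unfolding Cu
    by (intro sums_diff bounded_linear.sums[OF lin v(3)]
        bounded_linear.sums[OF bounded_linear_cscale v'(3)])
  moreover have "\<Delta> (cscale \<i> (\<rho> (Suc j) *\<^sub>R w (Suc j))) - cscale \<i> (\<rho> (Suc j) *\<^sub>R w' (Suc j))
      = \<rho> (Suc j) *\<^sub>R commutator_term (Suc j * \<kappa>) u" for j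
  proof (cases "\<rho> (Suc j) = 0")
    case True
    thus ?thesis
      using linear_simps(3)[OF lin] linear_simps(3)[OF bounded_linear_cscale] by simp
  next
    case False
    have "\<Delta> (cscale \<i> (\<rho> (Suc j) *\<^sub>R w (Suc j))) - cscale \<i> (\<rho> (Suc j) *\<^sub>R w' (Suc j))
      = \<rho> (Suc j) *\<^sub>R (\<Delta> (cscale \<i> (w (Suc j))) - cscale \<i> (w' (Suc j)))"
      using linear_simps(5)[OF lin] linear_simps(5)[OF bounded_linear_cscale]
      by (simp add: scaleR_diff_right)
    also have "\<Delta> (cscale \<i> (w (Suc j))) - cscale \<i> (w' (Suc j)) = commutator_term (Suc j * \<kappa>) u"
      by (rule commutator_conj_op) (use v(2) v'(2) False in auto)
    finally show ?thesis .
  qed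
  ultimately show ?thesis by simp
qed

section \<open>Spectral projections\<close>

text \<open>From the axioms of a projection-valued measure: projections of disjoint sets annihilate each
other, hence every scalar spectral measure of a projected vector is a restriction of the one of
the vector itself. For a bounded symmetric operator this makes its form diagonal with respect to
each splitting of the line into two Borel sets, which is all of the spectral theorem that the
localization of approximate eigenvectors uses.\<close>

context
  fixes T :: "'a ell2 \<Rightarrow> 'a ell2" and P :: "real set \<Rightarrow> 'a ell2 \<Rightarrow> 'a ell2"
  assumes P: "spectral_measure T P"
begin

lemma proj_linear: "B \<in> sets borel \<Longrightarrow> bounded_linear (P B)"
  and proj_idem: "B \<in> sets borel \<Longrightarrow> P B (P B u) = P B u"
  and proj_cinner: "B \<in> sets borel \<Longrightarrow> cinner (P B u) v = cinner u (P B v)"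
  and proj_UNIV: "P UNIV u = u"
  and proj_sums: "range A \<subseteq> sets borel \<Longrightarrow> disjoint_family A \<Longrightarrow>
        (\<lambda>k :: nat. P (A k) u) sums P (\<Union>k. A k) u"
  using P unfolding spectral_measure_def by blast+

lemma proj_inner: "B \<in> sets borel \<Longrightarrow> P B u \<bullet> v = u \<bullet> P B v"
  by (simp add: inner_eq_Re_cinner proj_cinner)

lemma norm_proj_sq: "B \<in> sets borel \<Longrightarrow> (norm (P B u))\<^sup>2 = u \<bullet> P B u"
  by (simp add: power2_norm_eq_inner proj_inner proj_idem)

lemma norm_proj_le:
  assumes "B \<in> sets borel"
  shows "norm (P B u) \<le> norm u"
proof -
  have "(norm (P B u))\<^sup>2 \<le> norm u * norm (P B u)"
    unfolding norm_proj_sq[OF assms] by (rule norm_cauchy_schwarz)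
  thus ?thesis by (cases "norm (P B u) = 0") (auto simp: power2_eq_square)
qed

lemma proj_empty: "P {} u = 0"
proof -
  have "(\<lambda>k :: nat. P {} u) sums P (\<Union>k :: nat. {}) u"
    by (rule proj_sums) (auto simp: disjoint_family_on_def)
  hence "(\<lambda>k :: nat. P {} u) \<longlonglongrightarrow> 0"
    using sums_summable summable_LIMSEQ_zero by blast
  thus ?thesis by (simp add: LIMSEQ_const_iff)
qed

lemma proj_Un:
  assumes "A \<in> sets borel" "B \<in> sets borel" "A \<inter> B = {}"
  shows "P (A \<union> B) u = P A u + P B u"
proof -
  have "(\<lambda>k. P (binaryset A B k) u) sums P (\<Union>k. binaryset A B k) u"
    by (rule proj_sums) (use assms in \<open>auto simp: binaryset_def disjoint_family_on_def\<close>)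
  moreover have "(\<lambda>k. P (binaryset A B k) u) sums (P A u + P B u)"
    by (rule binaryset_sums) (rule proj_empty)
  ultimately show ?thesis by (simp add: UN_binaryset_eq sums_unique2)
qed

text \<open>Idempotence of \<open>P (A \<union> B) = P A + P B\<close> says \<open>P A P B + P B P A = 0\<close>. Multiplying by \<open>P A\<close> from the
left, and from both sides, gives first \<open>P A P B P A = 0\<close> and then \<open>P A P B = 0\<close>.\<close>

lemma proj_disjoint:
  assumes A: "A \<in> sets borel" and B: "B \<in> sets borel" and AB: "A \<inter> B = {}"
  shows "P A (P B u) = 0"
proof -
  have add: "P X (x + y) = P X x + P X y" if "X \<in> sets borel" for X x y
    using proj_linear[OF that] by (rule linear_simps)
  have sum0: "P A (P B u) + P B (P A u) = 0" for u
  proof -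
    have "P (A \<union> B) (P (A \<union> B) u) = P (A \<union> B) u"
      using A B by (intro proj_idem) auto
    thus ?thesis by (simp add: proj_Un[OF A B AB] add A B proj_idem)
  qed
  have *: "P A (P B u) + P A (P B (P A u)) = 0" for u
    using arg_cong[OF sum0[of u], of "P A"]
    by (simp add: add A proj_idem linear_simps[OF proj_linear[OF A]])
  have "P A (P B (P A u)) = 0"
    using *[of "P A u"] A by (simp add: proj_idem scaleR_2[symmetric])
  thus ?thesis using *[of u] by simp
qed

lemma proj_Int:
  assumes A: "A \<in> sets borel" and B: "B \<in> sets borel"
  shows "P A (P B u) = P (A \<inter> B) u"
proof -
  have add: "P A (x + y) = P A x + P A y" for x y
    using proj_linear[OF A] by (rule linear_simps)
  have "(A \<inter> B) \<union> (B - A) = B" "(A \<inter> B) \<union> (A - B) = A" by auto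
  hence 1: "P B u = P (A \<inter> B) u + P (B - A) u"
    and 2: "P A v = P (A \<inter> B) v + P (A - B) v" for v
    using proj_Un[of "A \<inter> B" "B - A" u] proj_Un[of "A \<inter> B" "A - B" v] A B
    by (simp_all add: Int_Diff_disjoint Int_Diff disjoint_iff)
  have "P A (P (B - A) u) = 0" by (rule proj_disjoint) (use A B in auto)
  moreover have "P (A - B) (P (A \<inter> B) u) = 0" by (rule proj_disjoint) (use A B in auto)
  ultimately show ?thesis using 2[of "P (A \<inter> B) u"] A B by (simp add: 1 add proj_idem)
qed

definition spectral_distr :: "'a ell2 \<Rightarrow> real measure" where
  "spectral_distr u = measure_of UNIV (sets borel) (\<lambda>B. ennreal ((norm (P B u))\<^sup>2))"

lemma distr_integral:
  "integrable (spectral_distr u) (\<lambda>x. x)"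
  "cinner u (T u) = complex_of_real (\<integral>x. x \<partial>spectral_distr u)"
  using P unfolding spectral_measure_def spectral_distr_def Let_def by blast+

lemma sets_spectral_distr [simp, measurable_cong]: "sets (spectral_distr u) = sets borel"
  by (simp add: spectral_distr_def sets_measure_of_conv sets.sigma_sets_eq[of borel, simplified])

lemma space_spectral_distr [simp]: "space (spectral_distr u) = UNIV"
  by (simp add: spectral_distr_def space_measure_of_conv)

lemma emeasure_spectral_distr:
  assumes "B \<in> sets borel"
  shows "emeasure (spectral_distr u) B = ennreal ((norm (P B u))\<^sup>2)"
proof (rule emeasure_measure_of[OF spectral_distr_def])
  show "positive (sets (spectral_distr u)) (\<lambda>B. ennreal ((norm (P B u))\<^sup>2))"
    by (simp add: positive_def proj_empty)
  show "countably_additive (sets (spectral_distr u)) (\<lambda>B. ennreal ((norm (P B u))\<^sup>2))"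
    unfolding countably_additive_def
  proof (intro allI impI)
    fix A :: "nat \<Rightarrow> real set"
    assume A: "range A \<subseteq> sets (spectral_distr u)" "disjoint_family A"
    hence A': "A k \<in> sets borel" for k by auto
    have "(\<lambda>k. P (A k) u) sums P (\<Union>k. A k) u" using A by (intro proj_sums) auto
    hence "(\<lambda>k. u \<bullet> P (A k) u) sums (u \<bullet> P (\<Union>k. A k) u)"
      by (rule bounded_linear.sums[OF bounded_linear_inner_right])
    hence "(\<lambda>k. (norm (P (A k) u))\<^sup>2) sums ((norm (P (\<Union>k. A k) u))\<^sup>2)"
      using A' by (simp add: norm_proj_sq)
    thus "(\<Sum>i. ennreal ((norm (P (A i) u))\<^sup>2)) = ennreal ((norm (P (\<Union> (range A)) u))\<^sup>2)"
      by (intro suminf_ennreal_eq) auto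
  qed
qed (use assms in auto)

text \<open>Restricting the scalar measure of \<open>u\<close> to \<open>B\<close> is written as a density, so that integrals against it
become integrals over the original measure.\<close>

lemma spectral_distr_proj:
  assumes B: "B \<in> sets borel"
  shows "spectral_distr (P B u) = density (spectral_distr u) (indicator B)"
proof (rule measure_eqI)
  fix A assume A: "A \<in> sets (spectral_distr (P B u))"
  have "emeasure (density (spectral_distr u) (indicator B)) A
      = (\<integral>\<^sup>+x. indicator (B \<inter> A) x \<partial>spectral_distr u)"
    using A B by (subst emeasure_density) (auto simp: indicator_inter_arith[symmetric] intro!: borel_measurable_indicator)
  also have "\<dots> = emeasure (spectral_distr u) (B \<inter> A)" using A B by (intro nn_integral_indicator) auto
  finally show "emeasure (spectral_distr (P B u)) A = emeasure (density (spectral_distr u) (indicator B)) A"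
    using A B by (simp add: emeasure_spectral_distr proj_Int Int_commute)
qed simp

lemma form_proj:
  assumes B: "B \<in> sets borel"
  shows "P B u \<bullet> T (P B u) = (\<integral>x. indicator B x * x \<partial>spectral_distr u)"
    and "integrable (spectral_distr u) (\<lambda>x. indicator B x * x)"
proof -
  have d: "spectral_distr (P B u) = density (spectral_distr u) (\<lambda>x. ennreal (indicator B x))"
    using spectral_distr_proj[OF B] by (simp add: ennreal_indicator)
  have "(\<integral>x. x \<partial>spectral_distr (P B u)) = (\<integral>x. indicator B x *\<^sub>R x \<partial>spectral_distr u)"
    unfolding d using B by (intro integral_density) (auto intro!: borel_measurable_indicator)
  thus "P B u \<bullet> T (P B u) = (\<integral>x. indicator B x * x \<partial>spectral_distr u)"
    by (simp add: inner_eq_Re_cinner distr_integral(2))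
  have "integrable (spectral_distr u) (\<lambda>x. indicator B x *\<^sub>R x)"
    by (rule integrable_mult_indicator[OF _ distr_integral(1)]) (use B in auto)
  thus "integrable (spectral_distr u) (\<lambda>x. indicator B x * x)" by simp
qed

lemma form_split:
  assumes B: "B \<in> sets borel"
  shows "u \<bullet> T u = P B u \<bullet> T (P B u) + P (- B) u \<bullet> T (P (- B) u)"
proof -
  have B': "- B \<in> sets borel" using B by auto
  have "u \<bullet> T u = (\<integral>x. x \<partial>spectral_distr u)" by (simp add: inner_eq_Re_cinner distr_integral(2))
  also have "\<dots> = (\<integral>x. indicator B x * x + indicator (- B) x * x \<partial>spectral_distr u)"
    by (intro Bochner_Integration.integral_cong) (auto simp: indicator_def)
  also have "\<dots> = P B u \<bullet> T (P B u) + P (- B) u \<bullet> T (P (- B) u)"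
    by (simp add: Bochner_Integration.integral_add form_proj B B')
  finally show ?thesis .
qed

lemma proj_compl: "B \<in> sets borel \<Longrightarrow> u = P B u + P (- B) u"
  using proj_Un[of B "- B" u] by (simp add: proj_UNIV)

context
  assumes linT: "bounded_linear T" and symT: "\<And>u v. T u \<bullet> v = u \<bullet> T v"
begin

text \<open>By \<open>form_split\<close> the form of \<open>P B u + P (- B) v\<close> is the sum of the forms of the two parts, so
the cross term, which is twice the left-hand side because \<open>T\<close> is symmetric, vanishes.\<close>

lemma proj_form_orthogonal:
  assumes B: "B \<in> sets borel"
  shows "P B u \<bullet> T (P (- B) v) = 0"
proof -
  have B': "- B \<in> sets borel" using B by auto
  define w where "w = P B u + P (- B) v"
  have w: "P B w = P B u" "P (- B) w = P (- B) v"
    using B B' by (simp_all add: w_def linear_simps[OF proj_linear] proj_idem proj_disjoint)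
  have "w \<bullet> T w = P B u \<bullet> T (P B u) + P (- B) v \<bullet> T (P (- B) v)"
    using form_split[OF B, of w] by (simp add: w)
  moreover have "w \<bullet> T w = P B u \<bullet> T (P B u) + P (- B) v \<bullet> T (P (- B) v)
      + 2 * (P B u \<bullet> T (P (- B) v))"
    using symT[of "P (- B) v" "P B u"]
    by (simp add: w_def linear_simps[OF linT] inner_add_left inner_add_right inner_commute)
  ultimately show ?thesis by simp
qed

text \<open>The sign \<open>s\<close> treats sets to the right and to the left of \<open>E\<close> at the same time.\<close>

lemma distr_mean_bound:
  assumes B: "B \<in> sets borel" and s: "s = 1 \<or> s = -1" and d: "\<And>x. x \<in> B \<Longrightarrow> d \<le> s * (x - E)"
  shows "d * (norm (P B u))\<^sup>2 \<le> s * (P B u \<bullet> (T (P B u) - E *\<^sub>R P B u))"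
proof -
  let ?M = "spectral_distr u"
  have meas: "measure ?M B = (norm (P B u))\<^sup>2"
    using emeasure_spectral_distr[OF B, of u] by (simp add: measure_def)
  have fin: "integrable ?M (\<lambda>x. indicator B x * e)" for e :: real
    using emeasure_spectral_distr[OF B, of u] B
    by (intro integrable_mult_left impI integrable_real_indicator) auto
  have int: "(\<integral>x. indicator B x * e \<partial>?M) = e * (norm (P B u))\<^sup>2" for e :: real
    using meas B by simp
  have "d * (norm (P B u))\<^sup>2 = (\<integral>x. indicator B x * d \<partial>?M)" by (simp only: int)
  also have "\<dots> \<le> (\<integral>x. s * (indicator B x * x) - indicator B x * (s * E) \<partial>?M)"
  proof (rule integral_mono)
    show "integrable ?M (\<lambda>x. s * (indicator B x * x) - indicator B x * (s * E))"
      by (intro Bochner_Integration.integrable_diff integrable_mult_right impI form_proj(2) B fin)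
    show "indicator B x * d \<le> s * (indicator B x * x) - indicator B x * (s * E)" for x
      using d[of x] by (auto simp: indicator_def algebra_simps)
  qed (rule fin)
  also have "\<dots> = s * (P B u \<bullet> T (P B u)) - s * E * (norm (P B u))\<^sup>2"
  proof -
    have "integrable ?M (\<lambda>x. s * (indicator B x * x))"
      by (intro integrable_mult_right impI form_proj(2) B)
    from Bochner_Integration.integral_diff[OF this fin] show ?thesis
      unfolding int by (simp add: form_proj(1) B)
  qed
  also have "\<dots> = s * (P B u \<bullet> (T (P B u) - E *\<^sub>R P B u))"
    by (simp add: inner_diff_right power2_norm_eq_inner algebra_simps)
  finally show ?thesis .
qed

text \<open>Pair \<open>(T - E) u\<close> with \<open>P B u\<close>: the part of \<open>u\<close> outside the range of \<open>P B\<close> drops out, and on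
that range \<open>s (T - E)\<close> is bounded below by \<open>d\<close>.\<close>

lemma proj_away_bound:
  assumes B: "B \<in> sets borel" and s: "s = 1 \<or> s = -1" and d: "\<And>x. x \<in> B \<Longrightarrow> d \<le> s * (x - E)"
  shows "d * norm (P B u) \<le> norm (T u - E *\<^sub>R u)"
proof -
  have u: "u = P B u + P (- B) u" by (rule proj_compl[OF B])
  have "P B u \<bullet> P (- B) u = 0"
    using B by (subst proj_inner) (auto simp: proj_disjoint)
  hence "P B u \<bullet> (T u - E *\<^sub>R u) = P B u \<bullet> (T (P B u) - E *\<^sub>R P B u)"
    using proj_form_orthogonal[OF B, of u u]
    by (subst (2 3) u) (simp add: linear_simps[OF linT] inner_add_right inner_diff_right)
  hence "d * (norm (P B u))\<^sup>2 \<le> s * (P B u \<bullet> (T u - E *\<^sub>R u))"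
    using distr_mean_bound[OF assms, of u] by simp
  also have "\<dots> \<le> \<bar>P B u \<bullet> (T u - E *\<^sub>R u)\<bar>" using s by auto
  also have "\<dots> \<le> norm (P B u) * norm (T u - E *\<^sub>R u)" by (rule Cauchy_Schwarz_ineq2)
  finally have "norm (P B u) * (d * norm (P B u)) \<le> norm (P B u) * norm (T u - E *\<^sub>R u)"
    by (simp add: power2_eq_square algebra_simps)
  thus ?thesis by (cases "norm (P B u) = 0") auto
qed

text \<open>An approximate eigenvector at \<open>E\<close> almost lies in the range of \<open>P I\<close>: the complement of \<open>I\<close> splits
into a part to the left and a part to the right of \<open>E\<close>, both at positive distance \<open>d\<close> from \<open>E\<close>,
and \<open>K = 2 / d\<close> works.\<close>

lemma spectral_localization:
  assumes I: "open I" "E \<in> I"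
  obtains K where "\<And>u. norm (u - P I u) \<le> K * norm (T u - E *\<^sub>R u)"
proof -
  obtain d where d: "d > 0" "ball E d \<subseteq> I" using I open_contains_ball by blast
  have I': "I \<in> sets borel" using I by auto
  define U where "U = {E<..} - I"
  define L where "L = {..<E} - I"
  have UL: "U \<in> sets borel" "L \<in> sets borel" "U \<inter> L = {}" using I' by (auto simp: U_def L_def)
  have "- I = U \<union> L" using I(2) by (auto simp: U_def L_def not_less_iff_gr_or_eq)
  hence eq: "u - P I u = P U u + P L u" for u
    using proj_compl[OF I', of u] proj_Un[OF UL, of u] by (simp add: algebra_simps)
  have away: "d \<le> \<bar>x - E\<bar>" if "x \<notin> I" for x
    using d that by (force simp: dist_real_def abs_minus_commute)
  have "d * norm (P U u) \<le> norm (T u - E *\<^sub>R u)" for u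
    by (rule proj_away_bound[where s = 1]) (use UL away in \<open>force simp: U_def\<close>)+
  moreover have "d * norm (P L u) \<le> norm (T u - E *\<^sub>R u)" for u
    by (rule proj_away_bound[where s = "-1"]) (use UL away in \<open>force simp: L_def\<close>)+
  ultimately have "norm (u - P I u) \<le> (2 / d) * norm (T u - E *\<^sub>R u)" for u
  proof -
    assume *: "\<And>u. d * norm (P U u) \<le> norm (T u - E *\<^sub>R u)" "\<And>u. d * norm (P L u) \<le> norm (T u - E *\<^sub>R u)"
    have "d * norm (u - P I u) \<le> d * (norm (P U u) + norm (P L u))"
      unfolding eq using d by (intro mult_left_mono norm_triangle_ineq) auto
    also have "\<dots> \<le> 2 * norm (T u - E *\<^sub>R u)" using *[of u] by (simp add: distrib_left)
    finally show ?thesis using d by (simp add: field_simps)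
  qed
  thus ?thesis by (rule that)
qed

end

end

section \<open>Plane waves\<close>

definition lattice_box :: "nat \<Rightarrow> site set" where
  "lattice_box L = {n. \<forall>i. 0 \<le> n $ i \<and> n $ i < int L}"

lemma lattice_box_image: "lattice_box L = (\<lambda>(a, b). \<chi> i. if i = 1 then a else b) ` ({0..<int L} \<times> {0..<int L})"
proof
  show "lattice_box L \<subseteq> (\<lambda>(a, b). \<chi> i. if i = 1 then a else b) ` ({0..<int L} \<times> {0..<int L})"
  proof
    fix n assume "n \<in> lattice_box L"
    thus "n \<in> (\<lambda>(a, b). \<chi> i. if i = 1 then a else b) ` ({0..<int L} \<times> {0..<int L})"
      by (intro image_eqI[of _ _ "(n $ 1, n $ 2)"]) (auto simp: lattice_box_def vec_eq_iff forall_2)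
  qed
qed (auto simp: lattice_box_def)

lemma finite_lattice_box: "finite (lattice_box L)"
  unfolding lattice_box_image by auto

lemma card_lattice_box: "card (lattice_box L) = L ^ 2"
proof -
  have "inj_on (\<lambda>(a, b). (\<chi> i. if i = 1 then a else b) :: site) ({0..<int L} \<times> {0..<int L})"
    by (auto simp: inj_on_def vec_eq_iff forall_2)
  thus ?thesis unfolding lattice_box_image by (simp add: card_image power2_eq_square)
qed

text \<open>A shift by \<open>k\<close> changes membership in the box only for sites whose \<open>i\<close>-th coordinate is
  within \<open>\<bar>k\<bar>\<close> of one of the two ends, so the boundary layer is thin compared with the \<open>L\<^sup>2\<close>
  sites of the box.\<close>

lemma card_lattice_box_shift:
  "finite {n. (n - axis i k \<in> lattice_box L) \<noteq> (n \<in> lattice_box L)}" (is "finite ?D")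
  "card {n. (n - axis i k \<in> lattice_box L) \<noteq> (n \<in> lattice_box L)} \<le> (2 * (2 * nat \<bar>k\<bar> + 1)) * L"
proof -
  define S where "S = {-\<bar>k\<bar>..\<bar>k\<bar>} \<union> {int L - \<bar>k\<bar>..int L + \<bar>k\<bar>}"
  define f :: "int \<times> int \<Rightarrow> site" where "f = (\<lambda>(a, b). \<chi> m. if m = i then a else b)"
  obtain i' where i': "i' \<noteq> i" "\<And>m. m = i \<or> m = i'"
  proof (cases "i = 1")
    case True
    thus ?thesis using that[of 2] exhaust_2 by auto
  next
    case False
    thus ?thesis using that[of 1] exhaust_2 by metis
  qed
  have sub: "?D \<subseteq> f ` (S \<times> {0..<int L})"
  proof
    fix n assume n: "n \<in> ?D"
    have all: "(\<forall>m. Q m) \<longleftrightarrow> Q i \<and> Q i'" for Q using i'(2) by metis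
    have "n $ i' \<in> {0..<int L}" "n $ i \<in> S"
      using n i'(1) by (auto simp: lattice_box_def all S_def)
    moreover have "n = f (n $ i, n $ i')" using i'(2) by (auto simp: f_def vec_eq_iff)
    ultimately show "n \<in> f ` (S \<times> {0..<int L})" by blast
  qed
  have fin: "finite (S \<times> {0..<int L})" by (auto simp: S_def)
  show "finite ?D" by (rule finite_subset[OF sub]) (use fin in auto)
  have "card ?D \<le> card (f ` (S \<times> {0..<int L}))" by (rule card_mono[OF _ sub]) (use fin in auto)
  also have "\<dots> \<le> card (S \<times> {0..<int L})" by (rule card_image_le[OF fin])
  also have "\<dots> = card S * L" by (simp add: card_cartesian_product)
  also have "\<dots> \<le> (2 * (2 * nat \<bar>k\<bar> + 1)) * L"
  proof (rule mult_right_mono)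
    show "card S \<le> 2 * (2 * nat \<bar>k\<bar> + 1)"
      unfolding S_def by (rule order_trans[OF card_Un_le]) simp
  qed simp
  finally show "card ?D \<le> (2 * (2 * nat \<bar>k\<bar> + 1)) * L" .
qed

text \<open>The plane wave \<open>exp (\<i> (\<theta>\<^sub>1 n\<^sub>1 + \<theta>\<^sub>2 n\<^sub>2))\<close> is cut off to a box of side \<open>L + 1\<close>, which is never
empty, and normalized.\<close>

definition wave_seq :: "real ^ 2 \<Rightarrow> nat \<Rightarrow> site \<Rightarrow> complex" where
  "wave_seq \<theta> L n = (if n \<in> lattice_box (Suc L) then cis (\<Sum>i\<in>UNIV. \<theta> $ i * of_int (n $ i)) / of_nat (Suc L) else 0)"

definition wave :: "real ^ 2 \<Rightarrow> nat \<Rightarrow> site ell2" where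
  "wave \<theta> L = Abs_ell2 (wave_seq \<theta> L)"

lemma seq_wave: "seq (wave \<theta> L) = wave_seq \<theta> L"
proof -
  have "(\<lambda>n. (cmod (wave_seq \<theta> L n))\<^sup>2) summable_on UNIV"
    by (rule finite_support_summable[OF finite_lattice_box[of "Suc L"]]) (simp add: wave_seq_def)
  thus ?thesis unfolding wave_def by (subst Abs_ell2_inverse) auto
qed

lemma wave_compactly_supported: "wave \<theta> L \<in> compactly_supported"
proof -
  have "{n. seq (wave \<theta> L) n \<noteq> 0} \<subseteq> lattice_box (Suc L)" by (auto simp: seq_wave wave_seq_def)
  thus ?thesis
    unfolding compactly_supported_def using finite_subset[OF _ finite_lattice_box] by blast
qed

lemma norm_wave: "norm (wave \<theta> L) = 1"
proof -
  have "(norm (wave \<theta> L))\<^sup>2 = (\<Sum>n\<in>lattice_box (Suc L). (cmod (wave_seq \<theta> L n))\<^sup>2)"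
    unfolding norm_ell2_sq seq_wave
    by (rule finite_support_infsum[OF finite_lattice_box]) (simp add: wave_seq_def)
  also have "\<dots> = (\<Sum>n\<in>lattice_box (Suc L). (1 / real (Suc L))\<^sup>2)"
    by (intro sum.cong) (auto simp: wave_seq_def norm_divide simp del: of_nat_Suc)
  also have "\<dots> = 1" by (simp add: card_lattice_box power_divide del: of_nat_Suc)
  finally show ?thesis using norm_ge_zero[of "wave \<theta> L"] by (auto simp: power2_eq_1_iff)
qed

text \<open>The uncut wave is an exact eigenvector of the shift. The cut-off produces an error of modulus
\<open>1 / (L + 1)\<close> on the boundary layer, which has at most \<open>M (L + 1)\<close> sites.\<close>

lemma wave_shift:
  "(\<lambda>L. shift i k (wave \<theta> L) - cscale (cis (- (k * \<theta> $ i))) (wave \<theta> L)) \<longlonglongrightarrow> 0"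
proof -
  let ?e = "\<lambda>L. shift i k (wave \<theta> L) - cscale (cis (- (k * \<theta> $ i))) (wave \<theta> L)"
  \<comment> \<open>the boundary layer, outside of which cut-off and shift commute\<close>
  define D where "D L = {n. (n - axis i k \<in> lattice_box (Suc L)) \<noteq> (n \<in> lattice_box (Suc L))}" for L
  define M where "M = real (2 * (2 * nat \<bar>k\<bar> + 1))"
  have phase: "(\<Sum>m\<in>UNIV. \<theta> $ m * of_int ((n - axis i k) $ m))
      = - (k * \<theta> $ i) + (\<Sum>m\<in>UNIV. \<theta> $ m * of_int (n $ m))" for n :: site
    by (cases "i = 1") (use exhaust_2[of i] in \<open>auto simp: sum_2 algebra_simps\<close>)
  have bound: "(norm (?e L))\<^sup>2 \<le> M / real (Suc L)" for L
  proof -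
    have off: "seq (?e L) n = 0" if "n \<notin> D L" for n
      using that phase[of n] by (auto simp: D_def seq_wave wave_seq_def cis_mult)
    have on: "cmod (seq (?e L) n) = 1 / real (Suc L)" if "n \<in> D L" for n
      using that by (auto simp: D_def seq_wave wave_seq_def norm_mult norm_divide simp del: of_nat_Suc)
    have "(norm (?e L))\<^sup>2 = (\<Sum>n\<in>D L. (cmod (seq (?e L) n))\<^sup>2)"
      unfolding norm_ell2_sq
    proof (rule finite_support_infsum)
      show "finite (D L)" unfolding D_def by (rule card_lattice_box_shift)
    qed (rule off)
    also have "\<dots> = (\<Sum>n\<in>D L. (1 / real (Suc L))\<^sup>2)" by (intro sum.cong) (simp_all only: on)
    also have "\<dots> = real (card (D L)) * (1 / real (Suc L))\<^sup>2" by simp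
    also have "\<dots> \<le> (M * real (Suc L)) * (1 / real (Suc L))\<^sup>2"
    proof (rule mult_right_mono)
      have "real (card (D L)) \<le> real ((2 * (2 * nat \<bar>k\<bar> + 1)) * Suc L)"
        unfolding D_def of_nat_le_iff by (rule card_lattice_box_shift)
      thus "real (card (D L)) \<le> M * real (Suc L)" by (simp only: M_def of_nat_mult)
    qed simp
    also have "\<dots> = M / real (Suc L)" by (simp add: power2_eq_square)
    finally show ?thesis .
  qed
  have "(\<lambda>L. M / real (Suc L)) \<longlonglongrightarrow> 0"
    using tendsto_mult_right_zero[OF LIMSEQ_inverse_real_of_nat, of M] by (simp add: divide_inverse)
  hence "(\<lambda>L. (norm (?e L))\<^sup>2) \<longlonglongrightarrow> 0"
    by (rule tendsto_sandwich[OF _ _ tendsto_const, rotated 2]) (use bound in auto)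
  hence "(\<lambda>L. sqrt ((norm (?e L))\<^sup>2)) \<longlonglongrightarrow> sqrt 0" by (rule tendsto_real_sqrt)
  thus ?thesis by (simp add: tendsto_norm_zero_iff)
qed

lemma cis_cscale: "cscale (cis (- t)) u + cscale (cis t) u = (2 * cos t) *\<^sub>R u"
  by (rule ell2_eqI) (simp add: scaleR_conv_of_real complex_eq_iff algebra_simps)

lemma wave_Laplacian:
  "(\<lambda>L. \<Delta> (wave \<theta> L) - (\<Sum>i\<in>UNIV. cos (\<theta> $ i)) *\<^sub>R wave \<theta> L) \<longlonglongrightarrow> 0"
proof -
  let ?e = "\<lambda>i k L. shift i k (wave \<theta> L) - cscale (cis (- (of_int k * \<theta> $ i))) (wave \<theta> L)"
  have "(\<lambda>L. \<Sum>i\<in>UNIV. (1/2) *\<^sub>R (?e i 1 L + ?e i (- 1) L)) \<longlonglongrightarrow> (\<Sum>i\<in>(UNIV :: 2 set). (1/2) *\<^sub>R (0 + 0))"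
    by (intro tendsto_intros wave_shift)
  moreover have "(1/2) *\<^sub>R (?e i 1 L + ?e i (- 1) L)
      = (1/2) *\<^sub>R (shift i 1 (wave \<theta> L) + shift i (- 1) (wave \<theta> L)) - cos (\<theta> $ i) *\<^sub>R wave \<theta> L" for i L
  proof -
    have "?e i 1 L + ?e i (- 1) L = (shift i 1 (wave \<theta> L) + shift i (- 1) (wave \<theta> L))
       - (cscale (cis (- (\<theta> $ i))) (wave \<theta> L) + cscale (cis (\<theta> $ i)) (wave \<theta> L))" by simp
    thus ?thesis by (simp only: cis_cscale scaleR_diff_right) simp
  qed
  ultimately show ?thesis by (simp add: Laplacian_def sum_subtractf scaleR_sum_left)
qed

text \<open>The symbol is \<open>(2 cos ((k - 1) \<theta>\<^sub>i) - 2 cos ((k + 1) \<theta>\<^sub>i)) / 4 = sin \<theta>\<^sub>i sin (k \<theta>\<^sub>i)\<close> in each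
direction.\<close>

lemma wave_commutator_term:
  "(\<lambda>L. commutator_term k (wave \<theta> L) - (\<Sum>i\<in>UNIV. sin (\<theta> $ i) * sin (k * \<theta> $ i)) *\<^sub>R wave \<theta> L) \<longlonglongrightarrow> 0"
proof -
  let ?e = "\<lambda>i k L. shift i k (wave \<theta> L) - cscale (cis (- (of_int k * \<theta> $ i))) (wave \<theta> L)"
  let ?s = "\<lambda>i L. (1/4) *\<^sub>R (?e i (int k - 1) L + ?e i (1 - int k) L - ?e i (int k + 1) L - ?e i (- int k - 1) L)"
  have "(\<lambda>L. \<Sum>i\<in>UNIV. ?s i L) \<longlonglongrightarrow> (\<Sum>i\<in>(UNIV :: 2 set). (1/4) *\<^sub>R (0 + 0 - 0 - 0))"
    by (intro tendsto_intros wave_shift)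
  moreover have "?s i L = (1/4) *\<^sub>R (shift i (int k - 1) (wave \<theta> L) + shift i (1 - int k) (wave \<theta> L)
     - shift i (int k + 1) (wave \<theta> L) - shift i (- int k - 1) (wave \<theta> L))
     - (sin (\<theta> $ i) * sin (k * \<theta> $ i)) *\<^sub>R wave \<theta> L" for i L
  proof -
    define u where "u = wave \<theta> L"
    define a where "a = (real k - 1) * \<theta> $ i"
    define b where "b = (real k + 1) * \<theta> $ i"
    have 1: "of_int (int k - 1) * \<theta> $ i = a" "of_int (1 - int k) * \<theta> $ i = - a"
      "of_int (int k + 1) * \<theta> $ i = b" "of_int (- int k - 1) * \<theta> $ i = - b"
      by (simp_all add: a_def b_def algebra_simps)
    have "2 * cos a - 2 * cos b = 4 * (sin (\<theta> $ i) * sin (k * \<theta> $ i))"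
    proof -
      have ab: "a = k * \<theta> $ i - \<theta> $ i" "b = k * \<theta> $ i + \<theta> $ i" by (simp_all add: a_def b_def algebra_simps)
      show ?thesis unfolding ab cos_add cos_diff by simp
    qed
    moreover have "?s i L = (1/4) *\<^sub>R (shift i (int k - 1) u + shift i (1 - int k) u
     - shift i (int k + 1) u - shift i (- int k - 1) u
     - ((cscale (cis (- a)) u + cscale (cis a) u) - (cscale (cis (- b)) u + cscale (cis b) u)))"
      unfolding u_def[symmetric] 1 by simp
    ultimately show ?thesis
      unfolding cis_cscale scaleR_diff_left[symmetric] u_def[symmetric]
      by (simp only: scaleR_diff_right scaleR_scaleR) simp
  qed
  ultimately show ?thesis by (simp add: commutator_term_def sum_subtractf scaleR_sum_left)
qed

section \<open>Energies of finite order are thresholds\<close>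

lemma cheb_U_cos: "sin t * cheb_U n (cos t) = sin (real (Suc n) * t)"
proof (induction n "cos t" rule: cheb_U.induct)
  case 2
  show ?case by (simp add: sin_double)
next
  case (3 n)
  have "sin t * cheb_U (Suc (Suc n)) (cos t) =
      2 * cos t * sin (real (Suc (Suc n)) * t) - sin (real (Suc n) * t)"
    using 3 by (simp add: algebra_simps)
  also have "\<dots> = sin (real (Suc (Suc (Suc n))) * t)"
  proof -
    have 1: "real (Suc (Suc (Suc n))) * t = real (Suc (Suc n)) * t + t"
      and 2: "real (Suc n) * t = real (Suc (Suc n)) * t - t"
      by (simp_all add: algebra_simps)
    show ?thesis
      unfolding 1 2 sin_add sin_diff by (simp add: algebra_simps)
  qed
  finally show ?case .
qed simp

text \<open>The contribution of a single coordinate to \<open>g_fun\<close>.\<close>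

definition h_fun :: "nat \<Rightarrow> nat \<Rightarrow> real \<Rightarrow> real" where
  "h_fun j \<kappa> x = (1 - x\<^sup>2) * cheb_U (j * \<kappa> - 1) x"

lemma h_fun_cos:
  assumes "j \<ge> 1" "\<kappa> \<ge> 1"
  shows "h_fun j \<kappa> (cos t) = sin t * sin (real (j * \<kappa>) * t)"
proof -
  have "j * \<kappa> = Suc (j * \<kappa> - 1)" using assms by simp
  hence "sin (real (j * \<kappa>) * t) = sin t * cheb_U (j * \<kappa> - 1) (cos t)"
    using cheb_U_cos[of t "j * \<kappa> - 1"] by metis
  moreover have "1 - (cos t)\<^sup>2 = sin t * sin t"
    using sin_cos_squared_add[of t] by (simp add: power2_eq_square algebra_simps)
  ultimately show ?thesis by (simp add: h_fun_def)
qed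

lemma g_fun_eq: "g_fun j \<kappa> x = h_fun j \<kappa> (x $ 1) + h_fun j \<kappa> (x $ 2)"
  by (simp add: g_fun_def h_fun_def sum_2)

lemma surface_angles:
  assumes "x \<in> const_energy_surface E"
  obtains \<theta> :: "real ^ 2" where "\<And>i. x $ i = cos (\<theta> $ i)" "(\<Sum>i\<in>UNIV. cos (\<theta> $ i)) = E"
proof -
  define \<theta> :: "real ^ 2" where "\<theta> = (\<chi> i. arccos (x $ i))"
  have "x $ i = cos (\<theta> $ i)" for i
    using assms by (auto simp: const_energy_surface_def \<theta>_def)
  moreover from this have "(\<Sum>i\<in>UNIV. cos (\<theta> $ i)) = E"
    using assms by (simp add: const_energy_surface_def)
  ultimately show ?thesis by (rule that)
qed

lemma g_fun_angles:
  assumes "\<And>i. x $ i = cos (\<theta> $ i)" "j \<ge> 1" "\<kappa> \<ge> 1"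
  shows "g_fun j \<kappa> x = (\<Sum>i\<in>UNIV. sin (\<theta> $ i) * sin (real (j * \<kappa>) * \<theta> $ i))"
  using h_fun_cos[OF assms(2,3)] by (simp add: g_fun_eq assms(1) sum_2)

text \<open>A bounded inverse of \<open>\<Delta> - E\<close> would send the vectors \<open>(\<Delta> - E) u\<close>, which tend to \<open>0\<close> along
truncated plane waves \<open>u\<close> on the surface, back to unit vectors.\<close>

lemma energy_in_spectrum:
  assumes x: "x \<in> const_energy_surface E"
  shows "E \<in> \<sigma>\<Delta>"
proof -
  obtain \<theta> :: "real ^ 2" where \<theta>: "(\<Sum>i\<in>UNIV. cos (\<theta> $ i)) = E" using surface_angles[OF x] by blast
  have "\<not> (bounded_linear R \<and> (\<forall>u. R (\<Delta> u - cscale (complex_of_real E) u) = u))" for R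
  proof
    assume R: "bounded_linear R \<and> (\<forall>u. R (\<Delta> u - cscale (complex_of_real E) u) = u)"
    have "cscale (complex_of_real E) u = E *\<^sub>R u" for u :: "site ell2"
      by (rule ell2_eqI) (simp add: scaleR_conv_of_real)
    hence R2: "R (\<Delta> u - E *\<^sub>R u) = u" for u using R by simp
    have "(\<lambda>L. R (\<Delta> (wave \<theta> L) - E *\<^sub>R wave \<theta> L)) \<longlonglongrightarrow> 0"
      by (rule bounded_linear.tendsto_zero) (use R wave_Laplacian[of \<theta>] \<theta> in auto)
    hence "(\<lambda>L. norm (wave \<theta> L)) \<longlonglongrightarrow> 0" unfolding R2 by (rule tendsto_norm_zero)
    thus False by (simp add: norm_wave LIMSEQ_const_iff)
  qed
  thus ?thesis unfolding spectrum_Laplacian_def op_spectrum_def by blast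
qed

text \<open>Each term converges by \<open>wave_commutator_term\<close>. Summation and limit may be exchanged by
Tannery's theorem, because \<open>commutator_term\<close> is bounded uniformly in \<open>k\<close> and the coefficients are
absolutely summable.\<close>

lemma wave_commutator_form:
  assumes \<kappa>: "\<kappa> \<ge> 1" and \<rho>: "summable (\<lambda>j. \<bar>\<rho> (Suc j)\<bar>)"
    and C: "\<And>u. u \<in> compactly_supported \<Longrightarrow>
      (\<lambda>j. \<rho> (Suc j) *\<^sub>R commutator_term (Suc j * \<kappa>) u) sums C u"
    and x: "\<And>i. x $ i = cos (\<theta> $ i)"
  shows "summable (\<lambda>j. \<rho> (Suc j) * g_fun (Suc j) \<kappa> x)"
    and "(\<lambda>L. wave \<theta> L \<bullet> C (wave \<theta> L)) \<longlonglongrightarrow> (\<Sum>j. \<rho> (Suc j) * g_fun (Suc j) \<kappa> x)"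
proof -
  let ?a = "\<lambda>j L. \<rho> (Suc j) * (wave \<theta> L \<bullet> commutator_term (Suc j * \<kappa>) (wave \<theta> L))"
  have lim: "(\<lambda>L. ?a j L) \<longlonglongrightarrow> \<rho> (Suc j) * g_fun (Suc j) \<kappa> x" for j
  proof -
    let ?g = "g_fun (Suc j) \<kappa> x"
    let ?e = "\<lambda>L. commutator_term (Suc j * \<kappa>) (wave \<theta> L) - ?g *\<^sub>R wave \<theta> L"
    have e: "?e \<longlonglongrightarrow> 0"
      using wave_commutator_term[of "Suc j * \<kappa>" \<theta>] by (subst g_fun_angles[OF x]) (use \<kappa> in auto)
    have "(\<lambda>L. wave \<theta> L \<bullet> ?e L) \<longlonglongrightarrow> 0"
    proof (rule Lim_null_comparison[OF _ tendsto_norm_zero[OF e]])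
      show "\<forall>\<^sub>F L in sequentially. norm (wave \<theta> L \<bullet> ?e L) \<le> norm (?e L)"
        using Cauchy_Schwarz_ineq2[of "wave \<theta> _" "?e _"] by (intro always_eventually allI) (simp add: norm_wave)
    qed
    moreover have "wave \<theta> L \<bullet> ?e L = wave \<theta> L \<bullet> commutator_term (Suc j * \<kappa>) (wave \<theta> L) - ?g" for L
      by (simp add: inner_diff_right dot_square_norm norm_wave)
    ultimately have "(\<lambda>L. wave \<theta> L \<bullet> commutator_term (Suc j * \<kappa>) (wave \<theta> L)) \<longlonglongrightarrow> ?g"
      by (simp add: LIM_zero_iff)
    thus ?thesis by (rule tendsto_mult_left)
  qed
  have bound: "norm (?a j L) \<le> 2 * \<bar>\<rho> (Suc j)\<bar>" for j L
  proof -
    have "\<bar>wave \<theta> L \<bullet> commutator_term (Suc j * \<kappa>) (wave \<theta> L)\<bar> \<le> 1 * (2 * 1)"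
      using Cauchy_Schwarz_ineq2[of "wave \<theta> L" "commutator_term (Suc j * \<kappa>) (wave \<theta> L)"]
        norm_commutator_term[of "Suc j * \<kappa>" "wave \<theta> L"] by (simp add: norm_wave)
    thus ?thesis using mult_left_mono[of _ 2 "\<bar>\<rho> (Suc j)\<bar>"] by (fastforce simp: abs_mult mult.commute)
  qed
  have "\<forall>\<^sub>F (j, L) in sequentially \<times>\<^sub>F sequentially. norm (?a j L) \<le> 2 * \<bar>\<rho> (Suc j)\<bar>"
    using bound by (intro always_eventually) auto
  note tannery = tannerys_theorem[OF lim this summable_mult[OF \<rho>] trivial_limit_sequentially,
      THEN conjunct2]
  have "(\<Sum>j. ?a j L) = wave \<theta> L \<bullet> C (wave \<theta> L)" for L
    using bounded_linear.sums[OF bounded_linear_inner_right C[OF wave_compactly_supported], of "wave \<theta> L"]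
    by (simp add: sums_iff)
  thus "summable (\<lambda>j. \<rho> (Suc j) * g_fun (Suc j) \<kappa> x)"
    "(\<lambda>L. wave \<theta> L \<bullet> C (wave \<theta> L)) \<longlonglongrightarrow> (\<Sum>j. \<rho> (Suc j) * g_fun (Suc j) \<kappa> x)"
    using tannery by (simp_all add: summable_norm_cancel)
qed

text \<open>Truncated plane waves at \<open>E\<close> differ from their projections by vectors that tend to \<open>0\<close>, so in the
limit both projections may be dropped from the estimate.\<close>

lemma mourre_localized:
  assumes P: "spectral_measure \<Delta> P" and C: "bounded_linear C"
    and I: "open I" "E \<in> I" and E: "(\<Sum>i\<in>UNIV. cos (\<theta> $ i)) = E"
    and est: "op_le (\<lambda>u. \<gamma> *\<^sub>R P I u) (\<lambda>u. P I (C (P I u)))"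
    and lim: "(\<lambda>L. wave \<theta> L \<bullet> C (wave \<theta> L)) \<longlonglongrightarrow> G"
  shows "\<gamma> \<le> G"
proof -
  have I': "I \<in> sets borel" using I by auto
  obtain K where K: "\<And>u. norm (u - P I u) \<le> K * norm (\<Delta> u - E *\<^sub>R u)"
    using spectral_localization[OF P bounded_linear_Laplacian Laplacian_symmetric I] by blast
  define w where "w = wave \<theta>"
  have w1: "norm (w L) = 1" for L by (simp add: w_def norm_wave)
  have "(\<lambda>L. K * norm (\<Delta> (w L) - E *\<^sub>R w L)) \<longlonglongrightarrow> 0"
    using tendsto_norm_zero[OF wave_Laplacian[of \<theta>]] unfolding E w_def by (rule tendsto_mult_right_zero)
  hence d: "(\<lambda>L. w L - P I (w L)) \<longlonglongrightarrow> 0"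
    by (rule Lim_null_comparison[rotated]) (use K in auto)
  have Cd: "(\<lambda>L. C (w L - P I (w L))) \<longlonglongrightarrow> 0" by (rule bounded_linear.tendsto_zero[OF C d])
  obtain M where M: "\<And>u. norm (C u) \<le> norm u * M" using bounded_linear.bounded[OF C] by blast
  have lower: "\<gamma> * (w L \<bullet> P I (w L)) \<le> P I (w L) \<bullet> C (P I (w L))" for L
    using est proj_inner[OF P I', of "w L" "C (P I (w L))"] unfolding op_le_def by (metis inner_scaleR_right)
  \<comment> \<open>both sides of the estimate are compared with their values at the unprojected waves\<close>
  have wP: "(\<lambda>L. w L \<bullet> P I (w L)) \<longlonglongrightarrow> 1"
  proof -
    have "(\<lambda>L. w L \<bullet> (w L - P I (w L))) \<longlonglongrightarrow> 0"
    proof (rule Lim_null_comparison[OF _ tendsto_norm_zero[OF d]])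
      show "\<forall>\<^sub>F L in sequentially. norm (w L \<bullet> (w L - P I (w L))) \<le> norm (w L - P I (w L))"
        using Cauchy_Schwarz_ineq2[of "w _" "w _ - P I (w _)"] by (intro always_eventually allI) (simp add: w1)
    qed
    hence "(\<lambda>L. 1 - w L \<bullet> P I (w L)) \<longlonglongrightarrow> 0" by (simp add: inner_diff_right dot_square_norm w1)
    from tendsto_diff[OF tendsto_const[of 1] this] show ?thesis by simp
  qed
  have diff: "(\<lambda>L. w L \<bullet> C (w L) - P I (w L) \<bullet> C (P I (w L))) \<longlonglongrightarrow> 0"
  proof -
    have eq: "w L \<bullet> C (w L) - P I (w L) \<bullet> C (P I (w L))
        = (w L - P I (w L)) \<bullet> C (w L) + P I (w L) \<bullet> C (w L - P I (w L))" for L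
      by (simp add: linear_simps[OF C] inner_diff_left inner_diff_right)
    have "(\<lambda>L. (w L - P I (w L)) \<bullet> C (w L)) \<longlonglongrightarrow> 0"
    proof (rule Lim_null_comparison)
      show "\<forall>\<^sub>F L in sequentially. norm ((w L - P I (w L)) \<bullet> C (w L)) \<le> norm (w L - P I (w L)) * M"
      proof (intro always_eventually allI)
        fix L
        have "norm ((w L - P I (w L)) \<bullet> C (w L)) \<le> norm (w L - P I (w L)) * norm (C (w L))"
          using Cauchy_Schwarz_ineq2 by simp
        also have "\<dots> \<le> norm (w L - P I (w L)) * M"
          using M[of "w L"] by (intro mult_left_mono) (auto simp: w1)
        finally show "norm ((w L - P I (w L)) \<bullet> C (w L)) \<le> norm (w L - P I (w L)) * M" .
      qed
      show "(\<lambda>L. norm (w L - P I (w L)) * M) \<longlonglongrightarrow> 0"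
        by (rule tendsto_mult_left_zero[OF tendsto_norm_zero[OF d]])
    qed
    moreover have "(\<lambda>L. P I (w L) \<bullet> C (w L - P I (w L))) \<longlonglongrightarrow> 0"
    proof (rule Lim_null_comparison[OF _ tendsto_norm_zero[OF Cd]])
      show "\<forall>\<^sub>F L in sequentially. norm (P I (w L) \<bullet> C (w L - P I (w L))) \<le> norm (C (w L - P I (w L)))"
      proof (intro always_eventually allI)
        fix L
        have "norm (P I (w L) \<bullet> C (w L - P I (w L))) \<le> norm (P I (w L)) * norm (C (w L - P I (w L)))"
          using Cauchy_Schwarz_ineq2 by simp
        also have "\<dots> \<le> 1 * norm (C (w L - P I (w L)))"
          using norm_proj_le[OF P I', of "w L"] by (intro mult_right_mono) (auto simp: w1)
        finally show "norm (P I (w L) \<bullet> C (w L - P I (w L))) \<le> norm (C (w L - P I (w L)))" by simp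
      qed
    qed
    ultimately show ?thesis unfolding eq using tendsto_add by fastforce
  qed
  have "(\<lambda>L. P I (w L) \<bullet> C (P I (w L))) \<longlonglongrightarrow> G"
    using tendsto_diff[OF lim[folded w_def] diff] by simp
  moreover have "(\<lambda>L. \<gamma> * (w L \<bullet> P I (w L))) \<longlonglongrightarrow> \<gamma>"
    using tendsto_mult_left[OF wP, of \<gamma>] by simp
  ultimately show ?thesis using lower by (intro LIMSEQ_le) auto
qed

lemma Theta_fin_subset_Theta:
  assumes \<kappa>: "\<kappa> \<ge> 1"
  shows "Theta_fin m \<kappa> \<subseteq> Theta \<kappa>"
proof
  fix E assume "E \<in> Theta_fin m \<kappa>"
  then obtain x \<omega> where E: "E \<in> \<sigma>\<Delta>" and x: "\<And>q. q \<le> m \<Longrightarrow> x q \<in> const_energy_surface E"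
    and \<omega>: "\<And>q. q < m \<Longrightarrow> \<omega> q \<le> 0"
    and rel: "\<And>j. j \<ge> 1 \<Longrightarrow> g_fun j \<kappa> (x m) = (\<Sum>q<m. \<omega> q * g_fun j \<kappa> (x q))"
    unfolding Theta_fin_def by blast
  have "E \<notin> mu_set \<kappa>"
  proof
    assume "E \<in> mu_set \<kappa>"
    then obtain \<A> C P I \<gamma> where A: "conjugate_operator \<kappa> \<A>" and C: "bounded_commutator \<A> C"
      and P: "spectral_measure \<Delta> P" and I: "open I" "E \<in> I" and \<gamma>: "\<gamma> > 0"
      and est: "op_le (\<lambda>u. \<gamma> *\<^sub>R P I u) (\<lambda>u. P I (C (P I u)))"
      unfolding mu_set_def by blast
    obtain \<rho> where \<rho>: "linear_combination \<kappa> \<rho> \<subseteq> \<A>"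
      "compactly_supported \<subseteq> Domain (linear_combination \<kappa> \<rho>)"
      by (rule conjugate_operator_cases[OF A])
    have sum: "summable (\<lambda>j. \<bar>\<rho> (Suc j)\<bar>)"
      using \<rho>(2) delta0_compactly_supported by (intro linear_combination_coeffs_summable[OF \<kappa>]) auto
    define G where "G y = (\<Sum>j. \<rho> (Suc j) * g_fun (Suc j) \<kappa> y)" for y
    have G: "summable (\<lambda>j. \<rho> (Suc j) * g_fun (Suc j) \<kappa> y)" "\<gamma> \<le> G y"
      if "y \<in> const_energy_surface E" for y
    proof -
      obtain \<theta> where \<theta>: "\<And>i. y $ i = cos (\<theta> $ i)" "(\<Sum>i\<in>UNIV. cos (\<theta> $ i)) = E"
        using surface_angles[OF \<open>y \<in> _\<close>] by blast
      note form = wave_commutator_form[OF \<kappa> sum commutator_sums[OF \<rho> C] \<theta>(1)]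
      show "summable (\<lambda>j. \<rho> (Suc j) * g_fun (Suc j) \<kappa> y)" by (rule form(1))
      show "\<gamma> \<le> G y"
        unfolding G_def using C
        by (intro mourre_localized[OF P _ I \<theta>(2) est form(2)]) (auto simp: bounded_commutator_def)
    qed
    have "G (x m) = (\<Sum>j. \<Sum>q<m. \<omega> q * (\<rho> (Suc j) * g_fun (Suc j) \<kappa> (x q)))"
      unfolding G_def by (simp add: rel sum_distrib_left mult_ac)
    also have "\<dots> = (\<Sum>q<m. \<Sum>j. \<omega> q * (\<rho> (Suc j) * g_fun (Suc j) \<kappa> (x q)))"
      by (intro suminf_sum summable_mult G(1) x) auto
    also have "\<dots> = (\<Sum>q<m. \<omega> q * G (x q))"
      unfolding G_def by (intro sum.cong refl suminf_mult G(1) x) auto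
    also have "\<dots> \<le> 0"
    proof (intro sum_nonpos mult_nonpos_nonneg)
      fix q assume "q \<in> {..<m}"
      thus "\<omega> q \<le> 0" "0 \<le> G (x q)" using \<omega> G(2)[OF x[of q]] \<gamma> by auto
    qed
    finally show False using G(2)[OF x[of m]] \<gamma> by simp
  qed
  thus "E \<in> Theta \<kappa>" using E by (simp add: Theta_def)
qed

section \<open>Chains of points on an energy surface\<close>

text \<open>In the angle \<open>t\<close> with \<open>b = cos t\<close> this is the reflection at \<open>pi / \<kappa>\<close>. It exchanges the two branches of
the Chebyshev polynomial \<open>T\<^sub>\<kappa>\<close> that meet at its largest critical point \<open>cos (pi / \<kappa>)\<close>.\<close>

definition reflect :: "nat \<Rightarrow> real \<Rightarrow> real" where
  "reflect \<kappa> b = cos (2 * pi / \<kappa> - arccos b)"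

text \<open>The second coordinates of the points of the chain; the first coordinates are \<open>1\<close> and then
the reflections of the previous second coordinates.\<close>

fun chain :: "nat \<Rightarrow> real \<Rightarrow> nat \<Rightarrow> real" where
  "chain \<kappa> E 0 = E - 1"
| "chain \<kappa> E (Suc n) = E - reflect \<kappa> (chain \<kappa> E n)"

context
  fixes \<kappa> :: nat and c :: real
  assumes kappa: "\<kappa> \<ge> 2"
  defines "c \<equiv> cos (pi / \<kappa>)"
begin

lemma angle: "0 < pi / \<kappa>" "pi / \<kappa> \<le> pi / 2" "2 * pi / \<kappa> = 2 * (pi / \<kappa>)"
  using kappa by (auto simp: field_simps)

lemma fold_point_bounds: "0 \<le> c" "c < 1"
proof -
  show "0 \<le> c"
    unfolding c_def by (rule cos_ge_zero) (use angle pi_gt_zero in linarith)+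
  have "cos (pi / \<kappa>) < cos 0"
    by (rule cos_monotone_0_pi) (use angle pi_gt_zero in linarith)+
  thus "c < 1" by (simp add: c_def)
qed

lemma fold_point_double: "cos (2 * pi / \<kappa>) \<le> 2 * c - 1"
proof -
  have "cos (2 * pi / \<kappa>) = 2 * c\<^sup>2 - 1"
    unfolding angle(3) cos_double_cos c_def ..
  moreover have "c\<^sup>2 \<le> c"
    using fold_point_bounds by (simp add: power2_eq_square mult_left_le)
  ultimately show ?thesis by linarith
qed

lemma arccos_range:
  assumes "2 * c - 1 \<le> b" "b \<le> c"
  shows "pi / \<kappa> \<le> arccos b" "arccos b \<le> 2 * pi / \<kappa>"
proof -
  have "-1 \<le> b" "b \<le> 1" using assms fold_point_bounds by auto
  have "arccos c \<le> arccos b"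
    by (rule arccos_le_arccos) (use assms fold_point_bounds in auto)
  moreover have "arccos c = pi / \<kappa>"
    unfolding c_def by (rule arccos_cos) (use angle pi_gt_zero in linarith)+
  ultimately show "pi / \<kappa> \<le> arccos b" by simp
  have "arccos b \<le> arccos (cos (2 * pi / \<kappa>))"
    by (rule arccos_le_arccos) (use assms fold_point_double \<open>b \<le> 1\<close> in auto)
  also have "\<dots> = 2 * pi / \<kappa>"
    by (rule arccos_cos) (use angle pi_gt_zero in linarith)+
  finally show "arccos b \<le> 2 * pi / \<kappa>" .
qed

lemma reflect_strict:
  assumes "2 * c - 1 \<le> b" "b < c"
  shows "c < reflect \<kappa> b"
proof -
  have b: "-1 \<le> b" "b \<le> c" using assms fold_point_bounds by auto
  have "arccos c < arccos b"
    by (rule arccos_less_arccos) (use b assms fold_point_bounds in auto)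
  moreover have "arccos c = pi / \<kappa>"
    unfolding c_def by (rule arccos_cos) (use angle pi_gt_zero in linarith)+
  ultimately have "pi / \<kappa> < arccos b" by simp
  thus ?thesis
    unfolding reflect_def c_def
    by (intro cos_monotone_0_pi) (use angle arccos_range[OF assms(1) b(2)] pi_gt_zero in linarith)+
qed

lemma reflect_fold_point: "reflect \<kappa> c = c"
proof -
  have "arccos c = pi / \<kappa>"
    unfolding c_def by (rule arccos_cos) (use angle pi_gt_zero in linarith)+
  moreover have "2 * pi / \<kappa> - pi / \<kappa> = pi / \<kappa>" using angle(3) by linarith
  ultimately have "reflect \<kappa> c = cos (pi / \<kappa>)" by (simp only: reflect_def)
  thus ?thesis by (simp only: c_def)
qed

lemma reflect_antimono:
  assumes "2 * c - 1 \<le> b" "b \<le> b'" "b' \<le> c"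
  shows "reflect \<kappa> b' \<le> reflect \<kappa> b"
proof -
  have b: "2 * c - 1 \<le> b'" "b \<le> c" "-1 \<le> b" "b' \<le> 1" using assms fold_point_bounds by auto
  have "arccos b' \<le> arccos b"
    by (rule arccos_le_arccos) (use assms b in auto)
  thus ?thesis
    unfolding reflect_def
    by (intro cos_monotone_0_pi_le)
      (use angle arccos_range[OF assms(1) b(2)] arccos_range[OF b(1) assms(3)] pi_gt_zero in linarith)+
qed

text \<open>If \<open>b = cos (pi / \<kappa> + \<phi>)\<close>, its reflection is \<open>cos (pi / \<kappa> - \<phi>)\<close>, and the sum of the two is
\<open>2 * c * cos \<phi>\<close>. This is what makes the chain increase.\<close>

lemma add_reflect_le:
  assumes "2 * c - 1 \<le> b" "b \<le> c"
  shows "b + reflect \<kappa> b \<le> 2 * c"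
proof -
  define \<phi> where "\<phi> = arccos b - pi / \<kappa>"
  have b: "-1 \<le> b" "b \<le> 1" using assms fold_point_bounds by auto
  have *: "pi / \<kappa> + \<phi> = arccos b" by (simp add: \<phi>_def)
  have "b = cos (pi / \<kappa> + \<phi>)" unfolding * using b by (rule cos_arccos[symmetric])
  moreover have "reflect \<kappa> b = cos (pi / \<kappa> - \<phi>)"
    unfolding reflect_def angle(3) by (rule arg_cong[where f = cos]) (simp add: \<phi>_def)
  ultimately have "b + reflect \<kappa> b = 2 * c * cos \<phi>"
    by (simp add: cos_add cos_diff c_def)
  also have "\<dots> \<le> 2 * c * 1"
    using fold_point_bounds by (intro mult_left_mono) auto
  finally show ?thesis by simp
qed

lemma continuous_on_reflect: "continuous_on {-1..1} (reflect \<kappa>)"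
  unfolding reflect_def by (intro continuous_intros) auto

lemma h_fun_fold_point: "j \<ge> 1 \<Longrightarrow> h_fun j \<kappa> c = 0"
proof -
  assume j: "j \<ge> 1"
  have "real (j * \<kappa>) * (pi / \<kappa>) = real j * pi" using kappa by simp
  thus ?thesis
    unfolding c_def using h_fun_cos[of j \<kappa> "pi / \<kappa>"] j kappa by simp
qed

text \<open>If \<open>b = cos t\<close>, then \<open>sin (j * \<kappa> * (2 * pi / \<kappa> - t)) = - sin (j * \<kappa> * t)\<close> for every \<open>j\<close>, so
\<open>r = sin (2 * pi / \<kappa> - t) / sin t\<close> does not depend on \<open>j\<close>. The strict lower bound on \<open>b\<close> excludes
\<open>sin t = 0\<close>, which could occur only for \<open>\<kappa> = 2\<close>, at \<open>b = -1\<close>.\<close>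

lemma h_fun_reflect:
  assumes "2 * c - 1 < b" "b \<le> c"
  obtains r where "r \<ge> 0" "\<And>j. j \<ge> 1 \<Longrightarrow> h_fun j \<kappa> (reflect \<kappa> b) = - r * h_fun j \<kappa> b"
proof -
  define t where "t = arccos b"
  have b: "-1 < b" "b < 1" "2 * c - 1 \<le> b" using assms fold_point_bounds by auto
  have bt: "b = cos t" using b by (simp add: t_def)
  have t: "pi / \<kappa> \<le> t" "t \<le> 2 * pi / \<kappa>" using arccos_range[OF b(3) assms(2)] by (auto simp: t_def)
  have "0 < t" "t < pi" using b arccos_lt_bounded[of b] by (auto simp: t_def)
  hence sint: "sin t > 0" by (intro sin_gt_zero)
  have "sin (2 * pi / \<kappa> - t) \<ge> 0"
    by (rule sin_ge_zero) (use t angle pi_gt_zero in linarith)+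
  moreover have "h_fun j \<kappa> (reflect \<kappa> b) = - (sin (2 * pi / \<kappa> - t) / sin t) * h_fun j \<kappa> b"
    if j: "j \<ge> 1" for j
  proof -
    have "real (j * \<kappa>) * (2 * pi / \<kappa> - t) = - (real (j * \<kappa>) * t) + 2 * real j * pi"
      using kappa by (simp add: field_simps)
    hence "sin (real (j * \<kappa>) * (2 * pi / \<kappa> - t)) = - sin (real (j * \<kappa>) * t)"
      using sin.plus_of_nat[of "- (real (j * \<kappa>) * t)" j] by (simp add: mult_ac)
    moreover have "h_fun j \<kappa> (reflect \<kappa> b)
        = sin (2 * pi / \<kappa> - t) * sin (real (j * \<kappa>) * (2 * pi / \<kappa> - t))"
      unfolding reflect_def t_def[symmetric] using j kappa by (intro h_fun_cos) auto
    moreover have "h_fun j \<kappa> b = sin t * sin (real (j * \<kappa>) * t)"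
      unfolding bt using j kappa by (intro h_fun_cos) auto
    ultimately show ?thesis using sint by simp
  qed
  ultimately show ?thesis using sint that[of "sin (2 * pi / \<kappa> - t) / sin t"] by simp
qed

lemma chain_step:
  assumes "2 * c - 1 \<le> chain \<kappa> E n" "chain \<kappa> E n \<le> c"
  shows "chain \<kappa> E n + (E - 2 * c) \<le> chain \<kappa> E (Suc n)"
  using add_reflect_le[OF assms] by simp

lemma chain_lower:
  assumes "2 * c \<le> E" "\<And>q. q < n \<Longrightarrow> chain \<kappa> E q \<le> c"
  shows "E - 1 + n * (E - 2 * c) \<le> chain \<kappa> E n"
  using assms(2)
proof (induction n)
  case (Suc n)
  have IH: "E - 1 + n * (E - 2 * c) \<le> chain \<kappa> E n" using Suc by simp
  have "0 \<le> n * (E - 2 * c)" using assms(1) by simp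
  hence "2 * c - 1 \<le> chain \<kappa> E n" using IH assms(1) by linarith
  from chain_step[OF this] IH Suc.prems[of n] show ?case by (simp add: algebra_simps)
qed simp

lemma chain_ge:
  assumes "2 * c \<le> E" "\<And>q. q < n \<Longrightarrow> chain \<kappa> E q \<le> c"
  shows "E - 1 \<le> chain \<kappa> E n"
proof -
  have "0 \<le> n * (E - 2 * c)" using assms(1) by simp
  moreover have "E - 1 + n * (E - 2 * c) \<le> chain \<kappa> E n"
    by (rule chain_lower) (use assms in auto)
  ultimately show ?thesis by linarith
qed

text \<open>As the reflection is decreasing, \<open>E - reflect \<kappa> b\<close> is increasing in \<open>E\<close> and in \<open>b\<close>. It suffices to
control the chain of the larger energy \<open>E'\<close>, since this controls that of \<open>E\<close> too.\<close>

lemma chain_mono: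
  assumes "2 * c \<le> E" "E \<le> E'" "\<And>q. q < n \<Longrightarrow> chain \<kappa> E' q \<le> c"
  shows "chain \<kappa> E n \<le> chain \<kappa> E' n"
  using assms(3)
proof (induction n rule: less_induct)
  case (less n)
  show ?case
  proof (cases n)
    case (Suc m)
    have le: "chain \<kappa> E q \<le> c" if "q < n" for q
      using less.IH[OF that] less.prems[of q] less.prems that by force
    have "E - 1 \<le> chain \<kappa> E m" by (rule chain_ge) (use assms le Suc in auto)
    hence "reflect \<kappa> (chain \<kappa> E' m) \<le> reflect \<kappa> (chain \<kappa> E m)"
      by (intro reflect_antimono) (use less Suc assms in auto)
    thus ?thesis using Suc assms(2) by simp
  qed (use assms in simp)
qed

lemma continuous_on_chain:
  assumes "\<And>q E. q < n \<Longrightarrow> E \<in> {2 * c..e} \<Longrightarrow> chain \<kappa> E q \<le> c"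
  shows "continuous_on {2 * c..e} (\<lambda>E. chain \<kappa> E n)"
  using assms
proof (induction n)
  case 0
  show ?case by (auto intro!: continuous_intros)
next
  case (Suc n)
  have "continuous_on {2 * c..e} (\<lambda>E. reflect \<kappa> (chain \<kappa> E n))"
  proof (rule continuous_on_compose2[OF continuous_on_reflect])
    show "continuous_on {2 * c..e} (\<lambda>E. chain \<kappa> E n)" using Suc by simp
    show "(\<lambda>E. chain \<kappa> E n) ` {2 * c..e} \<subseteq> {- 1..1}"
    proof clarsimp
      fix E assume E: "2 * c \<le> E" "E \<le> e"
      have "E - 1 \<le> chain \<kappa> E n" by (rule chain_ge) (use E Suc.prems in auto)
      moreover have "chain \<kappa> E n \<le> c" using E Suc.prems by auto
      ultimately show "- 1 \<le> chain \<kappa> E n \<and> chain \<kappa> E n \<le> 1" using E fold_point_bounds by linarith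
    qed
  qed
  thus ?case by (auto intro!: continuous_intros)
qed

text \<open>At the left end point \<open>E = 2 * c\<close> the chain never reaches \<open>c\<close>: there
\<open>E - reflect \<kappa> b < 2 * c - c\<close>.\<close>

lemma chain_at_inf:
  "2 * c - 1 \<le> chain \<kappa> (2 * c) n \<and> chain \<kappa> (2 * c) n < c"
proof (induction n)
  case 0
  show ?case using fold_point_bounds by simp
next
  case (Suc n)
  thus ?case using reflect_strict[of "chain \<kappa> (2 * c) n"] chain_step[of "2*c" n] by auto
qed

text \<open>The two ways in which a chain that has stayed in the domain of reflection can close up.\<close>

definition hits_fold_at :: "nat \<Rightarrow> real \<Rightarrow> bool" where
  "hits_fold_at n E \<longleftrightarrow> 2 * c < E \<and> (\<forall>q<n. chain \<kappa> E q \<le> c) \<and> chain \<kappa> E n = c"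

definition hits_diagonal_at :: "nat \<Rightarrow> real \<Rightarrow> bool" where
  "hits_diagonal_at n E \<longleftrightarrow> 2 * c < E \<and> (\<forall>q<n. chain \<kappa> E q \<le> c) \<and> chain \<kappa> E n = E / 2"

lemma hits_fold_0: "hits_fold_at 0 (1 + c)"
  using fold_point_bounds by (simp add: hits_fold_at_def)

text \<open>Let the chain of \<open>e\<close> reach \<open>c\<close> after \<open>n\<close> steps. By monotonicity the first \<open>n\<close> steps do not exceed \<open>c\<close>
for all energies in \<open>[2 * c, e]\<close>, so the next step is continuous there. It lies below \<open>c\<close> at \<open>2 * c\<close>
and equals \<open>e - c > e / 2\<close> at \<open>e\<close>. The intermediate value theorem gives a crossing with
the diagonal \<open>E / 2\<close> at some \<open>d\<close>, and then, as \<open>d / 2 > c\<close>, a crossing with \<open>c\<close> at some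
\<open>e'\<close> below \<open>d\<close>.\<close>

lemma hits_next:
  assumes "hits_fold_at n e"
  obtains d e' where "hits_diagonal_at (Suc n) d" "hits_fold_at (Suc n) e'" "e' < d" "d < e"
proof -
  have e: "2 * c < e" "chain \<kappa> e n = c" and le: "\<And>q. q \<le> n \<Longrightarrow> chain \<kappa> e q \<le> c"
    using assms by (auto simp: hits_fold_at_def le_less)
  have below: "chain \<kappa> E q \<le> c" if "q < Suc n" "E \<in> {2 * c..e}" for q E
  proof -
    have "chain \<kappa> E q \<le> chain \<kappa> e q" by (rule chain_mono) (use that le in auto)
    also have "\<dots> \<le> c" using le that by simp
    finally show ?thesis .
  qed
  have cont: "continuous_on {2 * c..e} (\<lambda>E. chain \<kappa> E (Suc n))"
    by (rule continuous_on_chain) (rule below)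
  have top: "chain \<kappa> e (Suc n) = e - c" by (simp add: e reflect_fold_point)
  have bot: "chain \<kappa> (2 * c) (Suc n) < c" using chain_at_inf by blast
  have "\<exists>d\<ge>2 * c. d \<le> e \<and> chain \<kappa> d (Suc n) - d / 2 = 0"
  proof (rule IVT')
    show "chain \<kappa> (2 * c) (Suc n) - 2 * c / 2 \<le> 0" using bot by linarith
    show "0 \<le> chain \<kappa> e (Suc n) - e / 2" using top e by linarith
    show "continuous_on {2 * c..e} (\<lambda>E. chain \<kappa> E (Suc n) - E / 2)"
      by (intro continuous_on_diff[OF cont] continuous_intros) auto
  qed (use e in simp)
  then obtain d where d: "2 * c \<le> d" "d \<le> e" "chain \<kappa> d (Suc n) - d / 2 = 0" by blast
  have "d \<noteq> 2 * c"
  proof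
    assume "d = 2 * c"
    with d(3) have "chain \<kappa> (2 * c) (Suc n) - 2 * c / 2 = 0" by (simp only:)
    thus False using bot by linarith
  qed
  moreover have "d \<noteq> e"
  proof
    assume "d = e"
    with d(3) have "chain \<kappa> e (Suc n) - e / 2 = 0" by (simp only:)
    thus False using top e(1) by linarith
  qed
  ultimately have d2: "2 * c < d" "d < e" "c \<le> chain \<kappa> d (Suc n)" "c \<noteq> chain \<kappa> d (Suc n)"
    using d by linarith+
  have "continuous_on {2 * c..d} (\<lambda>E. chain \<kappa> E (Suc n))"
    by (rule continuous_on_subset[OF cont]) (use d in auto)
  hence "\<exists>e'\<ge>2 * c. e' \<le> d \<and> chain \<kappa> e' (Suc n) = c"
    by (intro IVT' less_imp_le[OF bot] d d2(3))
  then obtain e' where e': "2 * c \<le> e'" "e' \<le> d" "chain \<kappa> e' (Suc n) = c" by blast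
  have "e' \<noteq> 2 * c" "e' \<noteq> d" using e'(3) bot d2(4) by (metis less_irrefl)+
  hence e'2: "2 * c < e'" "e' < d" using e' by linarith+
  show ?thesis
  proof (rule that)
    show "hits_diagonal_at (Suc n) d"
      unfolding hits_diagonal_at_def
    proof (intro conjI allI impI)
      show "chain \<kappa> d (Suc n) = d / 2" using d(3) by linarith
      show "chain \<kappa> d q \<le> c" if "q < Suc n" for q by (rule below) (use that d in auto)
      qed (rule d2(1))
    show "hits_fold_at (Suc n) e'"
      unfolding hits_fold_at_def
    proof (intro conjI allI impI)
      show "chain \<kappa> e' q \<le> c" if "q < Suc n" for q by (rule below) (use that e' d in auto)
    qed (fact e'2(1) e'(3))+
  qed (fact e'2(2) d2(2))+
qed

text \<open>In \<open>n\<close> steps of length at least \<open>e - 2 * c\<close> the chain has come from \<open>e - 1\<close> to \<open>c\<close>.\<close>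

lemma hits_fold_rate:
  assumes "hits_fold_at n e"
  shows "e - 2 * c \<le> (1 - c) / (n + 1)"
proof -
  have e: "2 * c \<le> e" "\<And>q. q < n \<Longrightarrow> chain \<kappa> e q \<le> c" "chain \<kappa> e n = c"
    using assms unfolding hits_fold_at_def by (blast intro: less_imp_le)+
  have "e - 1 + n * (e - 2 * c) \<le> c"
    using chain_lower[OF e(1), of n, OF e(2)] unfolding e(3) by simp
  hence "(e - 2 * c) * (n + 1) \<le> 1 - c" by (simp add: algebra_simps)
  thus ?thesis by (simp add: pos_le_divide_eq)
qed

lemma exists_energy_sequences:
  obtains \<delta> \<epsilon> where "\<epsilon> 0 = 1 + c"
    "\<And>n. hits_fold_at n (\<epsilon> n)" "\<And>n. hits_diagonal_at (Suc n) (\<delta> (Suc n))"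
    "\<And>n. \<epsilon> (Suc n) < \<delta> (Suc n)" "\<And>n. \<delta> (Suc n) < \<epsilon> n"
proof -
  have "\<exists>f. \<forall>n. hits_fold_at n (f n) \<and> (n = 0 \<longrightarrow> f n = 1 + c) \<and>
      (\<exists>d. hits_diagonal_at (Suc n) d \<and> f (Suc n) < d \<and> d < f n)"
    by (rule dependent_nat_choice[where P = "\<lambda>n e. hits_fold_at n e \<and> (n = 0 \<longrightarrow> e = 1 + c)"
          and Q = "\<lambda>n e e'. \<exists>d. hits_diagonal_at (Suc n) d \<and> e' < d \<and> d < e", simplified conj_assoc])
      (use hits_fold_0 in blast, metis hits_next nat.distinct(1))
  then obtain \<epsilon> where e: "\<And>n. hits_fold_at n (\<epsilon> n)" "\<epsilon> 0 = 1 + c"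
    "\<And>n. \<exists>d. hits_diagonal_at (Suc n) d \<and> \<epsilon> (Suc n) < d \<and> d < \<epsilon> n" by blast
  then obtain d where d: "\<And>n. hits_diagonal_at (Suc n) (d n) \<and> \<epsilon> (Suc n) < d n \<and> d n < \<epsilon> n" by metis
  show ?thesis using that[of \<epsilon> "\<lambda>n. d (n - 1)"] e d by simp
qed

text \<open>Here \<open>a q\<close> and \<open>b q\<close> are the contributions of the first and the second coordinate of the \<open>q\<close>-th
point. The step is \<open>a (n + 1) = - r n * (g n - a n)\<close>, and in it the expansion of \<open>a n\<close> keeps its
signs because it is multiplied by \<open>r n\<close>.\<close>

lemma telescope_nonpos:
  fixes r :: "nat \<Rightarrow> real" and g :: "nat \<Rightarrow> 'a \<Rightarrow> real" and a b :: "nat \<Rightarrow> 'a \<Rightarrow> real"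
  assumes r: "\<And>q. q < n \<Longrightarrow> r q \<ge> 0"
    and g: "\<And>q j. q < n \<Longrightarrow> j \<in> J \<Longrightarrow> g q j = a q j + b q j"
    and a0: "\<And>j. j \<in> J \<Longrightarrow> a 0 j = 0"
    and a: "\<And>q j. q < n \<Longrightarrow> j \<in> J \<Longrightarrow> a (Suc q) j = - r q * b q j"
  shows "\<exists>\<omega>. (\<forall>q<n. \<omega> q \<le> 0) \<and> (\<forall>j\<in>J. a n j = (\<Sum>q<n. \<omega> q * g q j))"
  using assms
proof (induction n)
  case 0
  thus ?case by auto
next
  case (Suc n)
  then obtain \<omega> where \<omega>: "\<forall>q<n. \<omega> q \<le> 0" "\<forall>j\<in>J. a n j = (\<Sum>q<n. \<omega> q * g q j)"
    by force
  define \<omega>' where "\<omega>' = (\<lambda>q. if q = n then - r n else r n * \<omega> q)"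
  have "\<forall>q<Suc n. \<omega>' q \<le> 0"
    using \<omega> Suc.prems(1) by (auto simp: \<omega>'_def less_Suc_eq mult_nonneg_nonpos)
  moreover have "a (Suc n) j = (\<Sum>q<Suc n. \<omega>' q * g q j)" if "j \<in> J" for j
  proof -
    have "(\<Sum>q<Suc n. \<omega>' q * g q j) = r n * (\<Sum>q<n. \<omega> q * g q j) - r n * g n j"
      by (simp add: \<omega>'_def sum_distrib_left mult_ac)
    also have "\<dots> = r n * a n j - r n * g n j" using \<omega> that by simp
    also have "\<dots> = a (Suc n) j"
      using Suc.prems(2)[of n j] Suc.prems(4)[of n j] that by (simp add: algebra_simps)
    finally show ?thesis ..
  qed
  ultimately show ?case by blast
qed

text \<open>At the last point the whole of \<open>g_fun\<close> is \<open>s\<close> times the contribution of the first coordinate, with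
\<open>s = 1\<close> when the chain ends at \<open>c\<close> and \<open>s = 2\<close> when it ends on the diagonal.\<close>

lemma chain_Theta_fin:
  assumes E: "2 * c < E" "E \<le> 2"
    and le: "\<And>q. q < n \<Longrightarrow> chain \<kappa> E q \<le> c"
    and ends: "chain \<kappa> E n = c \<or> chain \<kappa> E n = E / 2" and n: "n \<ge> 1"
  shows "E \<in> Theta_fin n \<kappa>"
proof -
  define a where "a = (\<lambda>q. E - chain \<kappa> E q)"
  define x :: "nat \<Rightarrow> real ^ 2" where "x = (\<lambda>q. vector [a q, chain \<kappa> E q])"
  have low: "E - 1 \<le> chain \<kappa> E q" if "q \<le> n" for q
    by (rule chain_ge) (use E le that in auto)
  have up: "chain \<kappa> E q \<le> 1" if "q \<le> n" for q
    using le[of q] ends that E(2) fold_point_bounds by (cases "q = n") auto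
  have a_Suc: "a (Suc q) = reflect \<kappa> (chain \<kappa> E q)" for q by (simp add: a_def)
  have a_le: "a q \<le> 1" if "q \<le> n" for q using low[OF that] by (simp add: a_def)
  have a_ge: "-1 \<le> a q" if "q \<le> n" for q using up[OF that] E fold_point_bounds by (simp add: a_def)
  have S: "x q \<in> const_energy_surface E" if "q \<le> n" for q
    using that low[of q] up[of q] a_le[of q] a_ge[of q] E fold_point_bounds
    by (auto simp: const_energy_surface_def x_def forall_2 sum_2 vector_2 a_def)
  have "\<exists>r\<ge>0. \<forall>j\<ge>1. h_fun j \<kappa> (reflect \<kappa> (chain \<kappa> E q)) = - r * h_fun j \<kappa> (chain \<kappa> E q)"
    if "q < n" for q
    by (rule h_fun_reflect[of "chain \<kappa> E q"]) (use that low[of q] le[of q] E in auto)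
  then obtain r where r: "\<And>q. q < n \<Longrightarrow> r q \<ge> 0"
    "\<And>q j. q < n \<Longrightarrow> j \<ge> 1 \<Longrightarrow> h_fun j \<kappa> (a (Suc q)) = - r q * h_fun j \<kappa> (chain \<kappa> E q)"
    unfolding a_Suc by metis
  have "\<exists>\<omega>. (\<forall>q<n. \<omega> q \<le> 0) \<and> (\<forall>j\<in>{1..}. h_fun j \<kappa> (a n) = (\<Sum>q<n. \<omega> q * g_fun j \<kappa> (x q)))"
  proof (rule telescope_nonpos[where r = r and b = "\<lambda>q j. h_fun j \<kappa> (chain \<kappa> E q)"])
    show "h_fun j \<kappa> (a 0) = 0" for j by (simp add: a_def h_fun_def)
  qed (use r in \<open>auto simp: g_fun_eq x_def vector_2\<close>)
  then obtain \<omega> where \<omega>: "\<forall>q<n. \<omega> q \<le> 0"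
    "\<And>j. j \<ge> 1 \<Longrightarrow> h_fun j \<kappa> (a n) = (\<Sum>q<n. \<omega> q * g_fun j \<kappa> (x q))" by auto
  have "\<exists>s\<ge>0. \<forall>j\<ge>1. g_fun j \<kappa> (x n) = s * h_fun j \<kappa> (a n)"
    using ends
  proof
    assume "chain \<kappa> E n = c"
    thus ?thesis
      by (intro exI[of _ 1]) (simp add: g_fun_eq x_def vector_2 h_fun_fold_point)
  next
    assume *: "chain \<kappa> E n = E / 2"
    hence "a n = chain \<kappa> E n" by (simp add: a_def)
    thus ?thesis
      by (intro exI[of _ 2]) (simp add: g_fun_eq x_def vector_2)
  qed
  then obtain s where s: "s \<ge> 0" "\<And>j. j \<ge> 1 \<Longrightarrow> g_fun j \<kappa> (x n) = s * h_fun j \<kappa> (a n)" by blast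
  have "(\<forall>q\<le>n. x q \<in> const_energy_surface E) \<and> (\<forall>q<n. s * \<omega> q \<le> 0) \<and>
     (\<forall>j\<ge>1. g_fun j \<kappa> (x n) = (\<Sum>q<n. s * \<omega> q * g_fun j \<kappa> (x q)))"
    using S \<omega> s by (auto simp: sum_distrib_left mult_ac mult_nonneg_nonpos)
  moreover have "E \<in> \<sigma>\<Delta>" by (rule energy_in_spectrum[OF S[of 0]]) simp
  ultimately show ?thesis unfolding Theta_fin_def
    by (intro CollectI conjI exI[of _ x] exI[of _ "\<lambda>q. s * \<omega> q"]) auto
qed

text \<open>The two kinds of energies alternate. With the off-by-one of the indices, \<open>\<E> 0 = 1 + c\<close> is the
right end point of the interval, which is why all later terms lie strictly inside.\<close>

lemma energies:
  "\<exists>\<E>. strict_antimono_on {1..} \<E> \<and> (\<forall>n\<ge>1. 2 * c < \<E> n \<and> \<E> n < 1 + c) \<and> \<E> \<longlonglongrightarrow> 2 * c \<and>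
    (\<forall>n\<ge>1. \<E> (2 * n - 1) \<in> Theta_fin n \<kappa> \<and> \<E> (2 * n) \<in> Theta_fin n \<kappa>)"
proof -
  obtain \<delta> \<epsilon> where eps0: "\<epsilon> 0 = 1 + c" and eps: "\<And>n. hits_fold_at n (\<epsilon> n)"
    and del: "\<And>n. hits_diagonal_at (Suc n) (\<delta> (Suc n))"
    and less: "\<And>n. \<epsilon> (Suc n) < \<delta> (Suc n)" "\<And>n. \<delta> (Suc n) < \<epsilon> n"
    by (rule exists_energy_sequences) (rule that)
  define \<E> where "\<E> n = (if even n then \<epsilon> (n div 2) else \<delta> (Suc (n div 2)))" for n
  have step: "\<E> (Suc n) < \<E> n" for n
    using less by (auto simp: \<E>_def elim!: evenE oddE)
  have dec: "\<E> n < \<E> m" if "m < n" for m n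
    using lift_Suc_mono_less[of "\<lambda>n. - \<E> n", OF _ that] step by simp
  have low: "2 * c < \<E> n" for n
    using eps[of "n div 2"] del[of "n div 2"]
    unfolding \<E>_def hits_fold_at_def hits_diagonal_at_def by presburger
  have up: "\<E> n < 1 + c" if "n \<ge> 1" for n
    using dec[of 0 n] that by (simp add: \<E>_def eps0)
  have fin_even: "\<E> (2 * n) \<in> Theta_fin n \<kappa>" if n: "n \<ge> 1" for n
  proof (rule chain_Theta_fin)
    show "2 * c < \<E> (2 * n)" "\<E> (2 * n) \<le> 2" using low up[of "2 * n"] n fold_point_bounds by auto
    have eq: "\<E> (2 * n) = \<epsilon> n" by (simp add: \<E>_def)
    show "chain \<kappa> (\<E> (2 * n)) n = c \<or> chain \<kappa> (\<E> (2 * n)) n = \<E> (2 * n) / 2"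
      using eps[of n] unfolding eq hits_fold_at_def by blast
    show "chain \<kappa> (\<E> (2 * n)) q \<le> c" if "q < n" for q
      using eps[of n] that unfolding eq hits_fold_at_def by blast
  qed (rule n)
  have fin_odd: "\<E> (2 * n - 1) \<in> Theta_fin n \<kappa>" if n: "n \<ge> 1" for n
  proof (rule chain_Theta_fin)
    show "2 * c < \<E> (2 * n - 1)" by (rule low)
    have "2 * n - 1 \<ge> 1" using n by simp
    from up[OF this] show "\<E> (2 * n - 1) \<le> 2" using fold_point_bounds by linarith
    obtain m where m: "n = Suc m" using n by (cases n) auto
    hence eq: "\<E> (2 * n - 1) = \<delta> n" by (simp add: \<E>_def)
    have del_n: "hits_diagonal_at n (\<delta> n)" unfolding m by (rule del)
    show "chain \<kappa> (\<E> (2 * n - 1)) n = c \<or> chain \<kappa> (\<E> (2 * n - 1)) n = \<E> (2 * n - 1) / 2"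
      using del_n unfolding eq hits_diagonal_at_def by blast
    show "chain \<kappa> (\<E> (2 * n - 1)) q \<le> c" if "q < n" for q
      using del_n that unfolding eq hits_diagonal_at_def by blast
  qed (rule n)
  have rate: "\<E> n \<le> 2 * c + 2 * (1 - c) / real (Suc n)" for n
  proof -
    have "\<E> n \<le> \<epsilon> (n div 2)" using less(2)[of "n div 2"] by (simp add: \<E>_def)
    also have "\<dots> \<le> 2 * c + (1 - c) / (real (n div 2) + 1)"
      using hits_fold_rate[OF eps[of "n div 2"]] by (simp add: add.commute)
    also have "(1 - c) / (real (n div 2) + 1) \<le> (1 - c) / (real (Suc n) / 2)"
    proof (rule divide_left_mono)
      have "Suc n \<le> 2 * (n div 2) + 2" by presburger
      hence "real (Suc n) \<le> real (2 * (n div 2) + 2)" by (rule of_nat_mono)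
      thus "real (Suc n) / 2 \<le> real (n div 2) + 1" by simp
    qed (use fold_point_bounds in auto)
    finally show ?thesis by (simp add: mult.commute)
  qed
  have "(\<lambda>n. 2 * c + 2 * (1 - c) / real (Suc n)) \<longlonglongrightarrow> 2 * c + 0"
    using tendsto_mult_right_zero[OF LIMSEQ_inverse_real_of_nat, of "2 * (1 - c)"]
    by (intro tendsto_add tendsto_const) (simp add: divide_inverse)
  hence "\<E> \<longlonglongrightarrow> 2 * c"
    by (intro tendsto_sandwich[OF _ _ tendsto_const, of "2 * c" \<E>])
      (use less_imp_le[OF low] rate in \<open>auto intro!: always_eventually\<close>)
  moreover have "strict_antimono_on {1..} \<E>" by (rule monotone_onI) (rule dec)
  ultimately show ?thesis using low up fin_even fin_odd by blast
qed

end

theorem theorem1p7: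
  fixes \<kappa> :: nat
  assumes "\<kappa> \<ge> 2"
  shows "\<exists>\<E> :: nat \<Rightarrow> real.
    strict_antimono_on {1..} \<E> \<and>
    (\<forall>n\<ge>1. \<E> n \<in> J2 \<kappa> \<inter> Theta \<kappa>) \<and>
    \<E> \<longlonglongrightarrow> Inf (J2 \<kappa>) \<and> Inf (J2 \<kappa>) = 2 * cos (pi / \<kappa>) \<and>
    (\<forall>n\<ge>1. \<E> (2 * n - 1) \<in> Theta_fin n \<kappa> \<and> \<E> (2 * n) \<in> Theta_fin n \<kappa>)"
proof -
  obtain \<E> where E: "strict_antimono_on {1..} \<E>"
    "\<And>n. n \<ge> 1 \<Longrightarrow> 2 * cos (pi / \<kappa>) < \<E> n \<and> \<E> n < 1 + cos (pi / \<kappa>)"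
    "\<E> \<longlonglongrightarrow> 2 * cos (pi / \<kappa>)"
    "\<And>n. n \<ge> 1 \<Longrightarrow> \<E> (2 * n - 1) \<in> Theta_fin n \<kappa> \<and> \<E> (2 * n) \<in> Theta_fin n \<kappa>"
    using energies[OF assms] by blast
  have Inf: "Inf (J2 \<kappa>) = 2 * cos (pi / \<kappa>)"
    unfolding J2_def using fold_point_bounds(2)[OF assms] by (intro cInf_greaterThanLessThan) simp
  have "\<E> n \<in> Theta \<kappa>" if n: "n \<ge> 1" for n
  proof -
    define m where "m = Suc n div 2"
    have "m \<ge> 1" "n = 2 * m - 1 \<or> n = 2 * m" using n unfolding m_def by presburger+
    hence "\<E> n \<in> Theta_fin m \<kappa>" using E(4) by metis
    thus ?thesis using Theta_fin_subset_Theta[of \<kappa> m] assms by auto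
  qed
  thus ?thesis using E Inf by (intro exI[of _ \<E>]) (auto simp: J2_def)
qed

end
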